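(* Let $G$ be a finite abelian group of odd order $n=|G|\ge 7$. Then, as polynomials in the indeterminates $x_g$ ($g\in G$), $$\operatorname{imm}_{(4,1^{n-4})}(\mathcal M_G)=\operatorname{imm}_{(2,2,2,1^{n-6})}(\mathcal M_G).$$
   Context: Let $G$ be a finite abelian group of order $n$, written additively, and let $x_g$ ($g\in G$) be commuting indeterminates. The Cayley table of $G$ is the matrix $\mathcal M_G=(x_{a+b})_{a,b\in G}$ (rows and columns are identified with $G$). For a partition $\lambda\vdash n$, let $\chi^\lambda$ be the irreducible complex character of the symmetric group $\mathfrak S_n$ indexed by $\lambda$ (with $\chi^{(n)}$ trivial and $\chi^{(1^n)}=\operatorname{sgn}$), regarded as a character of the group $\mathfrak S(G)$ of permutations of the set $G$ via an identification $\mathfrak S(G)\cong\mathfrak S_n$ (its values depend only on cycle type). The immanant is $\operatorname{imm}_\lambda(\mathcal M_G)=\sum_{\sigma\in\mathfrak S(G)}\chi^\lambda(\sigma)\prod_{a\in G}x_{a+\sigma(a)}$. The notation $1^k$ in a partition means $k$ parts equal to $1$. *)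

theory Defs
  imports
    Complex_Main
    "HOL-Library.Function_Algebras"
    "HOL-Library.Poly_Mapping"
    "HOL-Combinatorics.Permutations"
    "HOL-Algebra.Coset"
begin

section \<open>Trace of an endomorphism of a space of complex functions\<close>

global_interpretation cfun: vector_space "\<lambda>(c::complex) (f :: 'x \<Rightarrow> complex) x. c * f x"
  by unfold_locales (auto simp: fun_eq_iff algebra_simps)

text \<open>
  The trace of \<open>F\<close> on a finite-dimensional subspace \<open>V\<close> with \<open>F ` V \<subseteq> V\<close>: the sum of the diagonal
  entries of the matrix of \<open>F\<close> with respect to a basis of \<open>V\<close>.
\<close>
definition trace_on :: "('x \<Rightarrow> complex) set \<Rightarrow> (('x \<Rightarrow> complex) \<Rightarrow> ('x \<Rightarrow> complex)) \<Rightarrow> complex" where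
  "trace_on V F =
     (let B = (SOME B. cfun.independent B \<and> cfun.span B = V)
      in \<Sum>b\<in>B. cfun.representation B (F b) b)"


section \<open>Specht modules and the irreducible characters of symmetric groups\<close>

text \<open>
  Partitions are weakly decreasing lists of positive parts. Instead of the letters \<open>1, \<dots>, n\<close>,
  tableaux have entries in an arbitrary finite set \<open>A\<close> whose size is that of the partition. The
  Specht module is then a representation of the group of all \<open>\<sigma>\<close> with \<open>\<sigma> permutes A\<close>, and every
  bijection from \<open>A\<close> to \<open>{1..n}\<close> identifies it with the usual Specht module of the symmetric group
  on \<open>n\<close> letters. Rows and columns are numbered from 0.
\<close>

definition young_diagram :: "nat list \<Rightarrow> (nat \<times> nat) set" where
  "young_diagram lam = {(i, j) . i < length lam \<and> j < lam ! i}"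

definition tableaux :: "nat list \<Rightarrow> 'a set \<Rightarrow> (nat \<times> nat \<Rightarrow> 'a) set" where
  "tableaux lam A = {t. bij_betw t (young_diagram lam) A}"

definition tab_row :: "nat list \<Rightarrow> (nat \<times> nat \<Rightarrow> 'a) \<Rightarrow> nat \<Rightarrow> 'a set" where
  "tab_row lam t i = {t (i, j) | j. (i, j) \<in> young_diagram lam}"

definition tab_col :: "nat list \<Rightarrow> (nat \<times> nat \<Rightarrow> 'a) \<Rightarrow> nat \<Rightarrow> 'a set" where
  "tab_col lam t j = {t (i, j) | i. (i, j) \<in> young_diagram lam}"

text \<open>
  The tabloid of \<open>t\<close>, that is, its class under row equivalence, is encoded by the function
  \<open>tab_row lam t\<close> sending \<open>i\<close> to the set of entries of row \<open>i\<close>. The permutation module on the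
  tabloids is a space of functions from tabloids to the complex numbers, in which the tabloid \<open>T\<close>
  is the indicator function of \<open>T\<close>.
\<close>

definition col_stabilizer :: "nat list \<Rightarrow> 'a set \<Rightarrow> (nat \<times> nat \<Rightarrow> 'a) \<Rightarrow> ('a \<Rightarrow> 'a) set" where
  "col_stabilizer lam A t = {q. q permutes A \<and> (\<forall>j. q ` tab_col lam t j = tab_col lam t j)}"

text \<open>The polytabloid \<open>e\<^sub>t\<close>, the sum over the column stabilizer of \<open>sign q\<close> times the tabloid of \<open>q \<circ> t\<close>.\<close>
definition polytabloid ::
  "nat list \<Rightarrow> 'a set \<Rightarrow> (nat \<times> nat \<Rightarrow> 'a) \<Rightarrow> ((nat \<Rightarrow> 'a set) \<Rightarrow> complex)" where
  "polytabloid lam A t =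
     (\<lambda>T. \<Sum>q\<in>col_stabilizer lam A t. if tab_row lam (q \<circ> t) = T then of_int (sign q) else 0)"

definition specht_module :: "nat list \<Rightarrow> 'a set \<Rightarrow> ((nat \<Rightarrow> 'a set) \<Rightarrow> complex) set" where
  "specht_module lam A = cfun.span (polytabloid lam A ` tableaux lam A)"

text \<open>
  The linear action that sends each tabloid \<open>T\<close> to \<open>\<lambda>i. \<sigma> ` T i\<close>; on coefficient functions this is
  composition with the inverse.
\<close>
definition tabloid_action ::
  "('a \<Rightarrow> 'a) \<Rightarrow> ((nat \<Rightarrow> 'a set) \<Rightarrow> complex) \<Rightarrow> ((nat \<Rightarrow> 'a set) \<Rightarrow> complex)" where
  "tabloid_action \<sigma> f = (\<lambda>T. f (\<lambda>i. inv_into UNIV \<sigma> ` T i))"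

definition sym_char :: "nat list \<Rightarrow> 'a set \<Rightarrow> ('a \<Rightarrow> 'a) \<Rightarrow> complex" where
  "sym_char lam A \<sigma> = trace_on (specht_module lam A) (tabloid_action \<sigma>)"


section \<open>Immanants of Cayley tables\<close>

text \<open>
  Polynomials with complex coefficients in indeterminates indexed by \<open>'a\<close>: finitely supported
  families of coefficients indexed by monomials, a monomial being a finitely supported family of
  exponents. Multiplication is convolution.
\<close>
type_synonym 'a cpoly = "('a \<Rightarrow>\<^sub>0 nat) \<Rightarrow>\<^sub>0 complex"

definition indet :: "'a \<Rightarrow> 'a cpoly" where
  "indet g = Poly_Mapping.single (Poly_Mapping.single g 1) 1"

definition const_poly :: "complex \<Rightarrow> 'a cpoly" where
  "const_poly c = Poly_Mapping.single 0 c"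

definition immanant :: "nat list \<Rightarrow> 'i set \<Rightarrow> ('i \<Rightarrow> 'i \<Rightarrow> 'a cpoly) \<Rightarrow> 'a cpoly" where
  "immanant lam A M =
     (\<Sum>\<sigma> | \<sigma> permutes A. const_poly (sym_char lam A \<sigma>) * (\<Prod>a\<in>A. M a (\<sigma> a)))"

definition cayley_table :: "('a, 'm) monoid_scheme \<Rightarrow> 'a \<Rightarrow> 'a \<Rightarrow> 'a cpoly" where
  "cayley_table G a b = indet (a \<otimes>\<^bsub>G\<^esub> b)"

end

theory Submission
  imports Defs "Jordan_Normal_Form.Determinant" "HOL-Algebra.Multiplicative_Group"
begin

text \<open>
  Conjugating the two partitions gives \<open>(n-3,1,1,1)\<close> and \<open>(n-3,3)\<close> and multiplies their characters
  by the sign. The first is the exterior cube of the \<open>(n-1)\<close>-dimensional reflection representation,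
  the second the permutation character on 3-subsets minus the one on 2-subsets. If \<open>\<sigma>\<close> has \<open>p\<close>
  fixed points and \<open>w\<close> is twice the number of its 2-cycles, the two characters differ at \<open>\<sigma>\<close> by
  \<open>sgn \<sigma> * (p - 1) * (1 - w)\<close> (\<open>character_difference\<close>). So the claim is that the sum over \<open>\<sigma>\<close> of
  \<open>sgn \<sigma> * (p - 1) * (1 - w) * (\<Prod>a. x (a + \<sigma> a))\<close> vanishes (\<open>cayley_signed_sum_zero\<close>).

  \<^bold>\<open>The characters.\<close> For a fixed tableau \<open>t\<close> the signed polytabloid of \<open>\<rho> \<circ> t\<close> depends only on the
  image of the columns of \<open>t\<close> under \<open>\<rho>\<close>. For the two shapes this is a triple of distinct points
  (the arm of the hook) or a 3-subset (the second column). Let \<open>gram\<close> be the matrix of inner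
  products of these spanning vectors. It inherits the linear relations of the vectors and is
  invariant under permutations of the letters, and these two properties determine each of its
  columns up to a factor (\<open>vanishing_on_triples\<close>, \<open>vanishing_alternating\<close>). Hence, after
  normalisation, it equals an explicit projection matrix, so that the vectors and the normalised
  inner products form a frame of the Specht module, and the trace of a permutation can be read off
  from a frame without choosing a basis (\<open>trace_on_frame\<close>).

  \<^bold>\<open>The vanishing sum.\<close> Let \<open>M\<close> be the matrix \<open>(x (a + b))\<close> and \<open>D\<close> its determinant. Where \<open>D\<close> is
  not a zero divisor, the adjugate of \<open>M\<close> has the entries \<open>y (a + b)\<close> for some \<open>y\<close>, and Jacobi's
  theorem on complementary minors expresses the signed sum over all \<open>\<sigma>\<close> with prescribed values on
  one, two or three points by \<open>y\<close> (\<open>jacobi_prescribed_values\<close>). Doubling is a bijection as \<open>n\<close> is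
  odd. It gives \<open>(\<Sum>d. x (2 d) * y (2 d)) = D\<close>, which says that weighting by \<open>p\<close> does not change the
  determinant. Expanding the 3 by 3 minors in the sum weighted by \<open>p * w\<close>, the terms with the factor
  \<open>y (2 d)\<close> collapse in the same way to the sum weighted by \<open>w\<close>, and each of the other four collapses,
  after a linear change of the summation variables, to plus or minus
  \<open>D * (\<Sum>g. (x g)\<^sup>2 * (y g)\<^sup>2)\<close>, with total \<open>0\<close> (\<open>cyclic_sum\<close>, \<open>square_sum\<close>). So the weights
  \<open>p * w\<close> and \<open>w\<close> also give equal sums.

  To have a regular determinant, a new variable is added to \<open>x 0\<close>, which makes \<open>D\<close> monic up to
  sign, and set to \<open>0\<close> in the end.
\<close>

hide_const (open) up_ring.coeff Polynomial.order

section \<open>Traces computed from a frame\<close>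

text \<open>
  The trace of \<open>\<Sum>i. v i \<otimes> (l i \<circ> F)\<close> is \<open>\<Sum>i. l i (F (v i))\<close>, whether or not the \<open>v i\<close> are linearly
  independent. So a spanning family that is permuted up to sign can be used directly.
\<close>
lemma trace_on_frame:
  fixes v :: "'i \<Rightarrow> 'x \<Rightarrow> complex" and l :: "'i \<Rightarrow> ('x \<Rightarrow> complex) \<Rightarrow> complex"
  assumes fin: "finite I" and V: "V = cfun.span (v ` I)"
    and F_add: "\<And>f g. F (f + g) = F f + F g"
    and F_scale: "\<And>c f. F (\<lambda>x. c * f x) = (\<lambda>x. c * F f x)"
    and F_V: "\<And>i. i \<in> I \<Longrightarrow> F (v i) \<in> V"
    and l_add: "\<And>i f g. l i (f + g) = l i f + l i g"
    and l_scale: "\<And>i c f. l i (\<lambda>x. c * f x) = c * l i f"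
    and frame: "\<And>j. j \<in> I \<Longrightarrow> (\<Sum>i\<in>I. (\<lambda>x. l i (v j) * v i x)) = v j"
  shows "trace_on V F = (\<Sum>i\<in>I. l i (F (v i)))"
proof -
  define B where "B = (SOME B. cfun.independent B \<and> cfun.span B = V)"
  have "\<exists>B. cfun.independent B \<and> cfun.span B = V"
    using cfun.basis_exists[of V] V by (metis cfun.span_eq_iff cfun.subspace_span cfun.span_minimal subset_antisym)
  then have B: "cfun.independent B" "cfun.span B = V"
    unfolding B_def by (metis (mono_tags, lifting) someI_ex)+
  have finB: "finite B"
    using cfun.independent_span_bound[of "v ` I" B] fin B V cfun.span_superset by auto
  let ?r = "cfun.representation B"
  have l0: "l i 0 = 0" for i
    using l_add[of i 0 0] by simp
  have F0: "F 0 = 0"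
    using F_add[of 0 0] by simp
  have l_sum: "l i (\<Sum>b\<in>S. g b) = (\<Sum>b\<in>S. l i (g b))" for i g and S :: "'y set"
  proof (induction S rule: infinite_finite_induct)
    case (insert b S)
    then show ?case by (simp only: sum.insert l_add not_False_eq_True)
  qed (use l0 in \<open>simp_all add: zero_fun_def\<close>)
  have F_sum: "F (\<Sum>b\<in>S. g b) = (\<Sum>b\<in>S. F (g b))" for g and S :: "'y set"
  proof (induction S rule: infinite_finite_induct)
    case (insert b S)
    then show ?case by (simp only: sum.insert F_add not_False_eq_True)
  qed (use F0 in \<open>simp_all add: zero_fun_def\<close>)
  have frame_V: "(\<Sum>i\<in>I. (\<lambda>x. l i u * v i x)) = u" if "u \<in> V" for u
    using that[unfolded V]
  proof (induction rule: cfun.span_induct_alt)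
    case base
    have "(\<lambda>x. l i 0 * v i x) = 0" for i using l0[of i] by (simp add: fun_eq_iff)
    then show ?case by (simp only: sum.neutral_const)
  next
    case (step c w u)
    then obtain j where j: "j \<in> I" "w = v j" by auto
    have "(\<Sum>i\<in>I. (\<lambda>x. l i ((\<lambda>x. c * w x) + u) * v i x))
        = (\<Sum>i\<in>I. (\<lambda>x. c * (l i w * v i x)) + (\<lambda>x. l i u * v i x))"
    proof (rule sum.cong)
      fix i assume "i \<in> I"
      have "l i ((\<lambda>x. c * w x) + u) = c * l i w + l i u"
        by (subst l_add, subst l_scale) (rule refl)
      then show "(\<lambda>x. l i ((\<lambda>x. c * w x) + u) * v i x)
          = (\<lambda>x. c * (l i w * v i x)) + (\<lambda>x. l i u * v i x)"
        by (simp only:) (rule ext, simp only: plus_fun_apply distrib_right mult.assoc)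
    qed (rule refl)
    also have "\<dots> = (\<lambda>x. c * (\<Sum>i\<in>I. (\<lambda>x. l i w * v i x)) x) + (\<Sum>i\<in>I. (\<lambda>x. l i u * v i x))"
      unfolding sum.distrib cfun.scale_sum_right[of c "\<lambda>i. (\<lambda>x. l i w * v i x)" I] ..
    also have "\<dots> = (\<lambda>x. c * w x) + u"
      using frame[OF j(1)] step.IH j(2) by simp
    finally show ?case .
  qed
  have F_in: "F u \<in> V" if "u \<in> V" for u
  proof -
    have "F u = (\<Sum>i\<in>I. (\<lambda>x. l i u * F (v i) x))"
      using F_sum[of "\<lambda>i. (\<lambda>x. l i u * v i x)" I] frame_V[OF that] F_scale by simp
    also have "\<dots> \<in> V"
      unfolding V by (intro cfun.span_sum cfun.span_scale) (use F_V V in auto)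
    finally show ?thesis .
  qed
  have rep: "?r (F b) b = (\<Sum>i\<in>I. l i b * ?r (F (v i)) b)" if "b \<in> B" for b
  proof -
    have bV: "b \<in> V" using that B(2) cfun.span_superset by auto
    have "F b = (\<Sum>i\<in>I. (\<lambda>x. l i b * F (v i) x))"
      using F_sum[of "\<lambda>i. (\<lambda>x. l i b * v i x)" I] frame_V[OF bV] F_scale by simp
    moreover have "(\<lambda>x. l i b * F (v i) x) \<in> cfun.span B" if "i \<in> I" for i
      using F_V[OF that] B(2) by (intro cfun.span_scale) simp
    ultimately have "?r (F b) = (\<lambda>a. \<Sum>i\<in>I. ?r (\<lambda>x. l i b * F (v i) x) a)"
      using cfun.representation_sum[OF B(1), of I "\<lambda>i x. l i b * F (v i) x"] by simp
    then show ?thesis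
      using F_V B by (simp add: cfun.representation_scale)
  qed
  have "trace_on V F = (\<Sum>b\<in>B. ?r (F b) b)"
    unfolding trace_on_def Let_def B_def ..
  also have "\<dots> = (\<Sum>b\<in>B. \<Sum>i\<in>I. l i b * ?r (F (v i)) b)"
    by (rule sum.cong) (auto simp: rep)
  also have "\<dots> = (\<Sum>i\<in>I. \<Sum>b\<in>B. l i (\<lambda>x. ?r (F (v i)) b * b x))"
    by (subst sum.swap) (simp add: l_scale[of _ "?r _ _"] mult.commute[of "l _ _"])
  also have "\<dots> = (\<Sum>i\<in>I. l i (\<Sum>b\<in>B. (\<lambda>x. ?r (F (v i)) b * b x)))"
    by (simp add: l_sum)
  also have "\<dots> = (\<Sum>i\<in>I. l i (F (v i)))"
    by (rule sum.cong) (use cfun.sum_representation_eq[OF B(1) _ finB order_refl] F_V B(2) in auto)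
  finally show ?thesis .
qed

section \<open>Specht modules in terms of column patterns\<close>
lemma tab_row_comp: "tab_row lam (r \<circ> t) = (\<lambda>i. r ` tab_row lam t i)"
  unfolding tab_row_def by (auto simp: fun_eq_iff)

lemma tab_col_comp: "tab_col lam (r \<circ> t) = (\<lambda>i. r ` tab_col lam t i)"
  unfolding tab_col_def by (auto simp: fun_eq_iff)

lemma young_diagram_Sigma: "young_diagram lam = (SIGMA i:{..<length lam}. {..<lam ! i})"
  unfolding young_diagram_def by auto

lemma finite_young_diagram: "finite (young_diagram lam)"
  unfolding young_diagram_Sigma by auto

lemma card_young_diagram: "card (young_diagram lam) = sum_list lam"
  unfolding young_diagram_Sigma by (simp add: sum_list_sum_nth atLeast0LessThan)

lemma tableau_ex:
  assumes "finite A" "card A = sum_list lam"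
  shows "\<exists>t. t \<in> tableaux lam A"
  unfolding tableaux_def using finite_same_card_bij[OF finite_young_diagram assms(1)] assms(2)
  by (auto simp: card_young_diagram)

text \<open>
  All tableaux are relabellings \<open>r \<circ> t\<close> of one tableau \<open>t\<close>. The type of \<open>pat r\<close> is chosen for each
  shape as a convenient encoding of the sets of entries of the columns of \<open>r \<circ> t\<close>, on which the
  polytabloid depends up to sign.
\<close>
locale column_pattern =
  fixes lam :: "nat list" and A :: "'a set" and t :: "nat \<times> nat \<Rightarrow> 'a"
    and pat :: "('a \<Rightarrow> 'a) \<Rightarrow> 'i" and act :: "('a \<Rightarrow> 'a) \<Rightarrow> 'i \<Rightarrow> 'i"
  assumes finite_A: "finite A"
    and tableau: "t \<in> tableaux lam A"
    and pat_eq_iff: "\<And>r s. r permutes A \<Longrightarrow> s permutes A \<Longrightarrow>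
      pat r = pat s \<longleftrightarrow> (\<forall>j. r ` tab_col lam t j = s ` tab_col lam t j)"
    and pat_comp: "\<And>s r. s permutes A \<Longrightarrow> r permutes A \<Longrightarrow> pat (s \<circ> r) = act s (pat r)"
    and act_inj: "\<And>s i j. s permutes A \<Longrightarrow> act s i = act s j \<Longrightarrow> i = j"
begin

abbreviation tabloid :: "('a \<Rightarrow> 'a) \<Rightarrow> nat \<Rightarrow> 'a set" where
  "tabloid r \<equiv> tab_row lam (r \<circ> t)"

definition fiber :: "'i \<Rightarrow> ('a \<Rightarrow> 'a) set" where
  "fiber i = {r. r permutes A \<and> pat r = i}"

definition alternating_sum :: "('a \<Rightarrow> 'a) set \<Rightarrow> (nat \<Rightarrow> 'a set) \<Rightarrow> complex" where
  "alternating_sum S T = (\<Sum>r\<in>S. if tabloid r = T then of_int (sign r) else 0)"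

text \<open>
  The polytabloid of \<open>r \<circ> t\<close> times \<open>sign r\<close>, for any \<open>r\<close> with pattern \<open>i\<close>, and \<open>0\<close> if \<open>i\<close> is not the
  pattern of a permutation. The sign makes it independent of \<open>r\<close>.
\<close>
definition vec :: "'i \<Rightarrow> (nat \<Rightarrow> 'a set) \<Rightarrow> complex" where
  "vec i = alternating_sum (fiber i)"

text \<open>The inner product with \<open>vec i\<close>, for which the tabloids are orthonormal.\<close>
definition coef :: "'i \<Rightarrow> ((nat \<Rightarrow> 'a set) \<Rightarrow> complex) \<Rightarrow> complex" where
  "coef i f = (\<Sum>r\<in>fiber i. of_int (sign r) * f (tabloid r))"

definition gram :: "'i \<Rightarrow> 'i \<Rightarrow> complex" where
  "gram j i = coef i (vec j)"

lemma finite_fiber: "finite (fiber i)"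
  unfolding fiber_def using finite_permutations[OF finite_A] by simp

lemma sign_comp: "r permutes A \<Longrightarrow> s permutes A \<Longrightarrow> sign (r \<circ> s) = sign r * sign s"
  using sign_compose permutes_imp_permutation[OF finite_A] by blast

lemma t_bij: "bij_betw t (young_diagram lam) A"
  using tableau unfolding tableaux_def by simp

text \<open>The substitution \<open>r = q \<circ> s\<close> turns the column stabilizer of \<open>s \<circ> t\<close> into a fiber of \<open>pat\<close>.\<close>
lemma polytabloid_comp:
  assumes s: "s permutes A"
  shows "polytabloid lam A (s \<circ> t) = (\<lambda>T. of_int (sign s) * vec (pat s) T)"
proof
  fix T
  have inv: "inv_into UNIV s permutes A" using permutes_inv[OF s] .
  let ?g = "\<lambda>r. if tabloid r = T then of_int (sign s * sign r) else (0::complex)"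
  have "polytabloid lam A (s \<circ> t) T
     = (\<Sum>q\<in>col_stabilizer lam A (s \<circ> t). if tabloid (q \<circ> s) = T then of_int (sign q) else 0)"
    unfolding polytabloid_def by (simp add: comp_assoc)
  also have "\<dots> = (\<Sum>r\<in>fiber (pat s). ?g r)"
  proof (rule sum.reindex_bij_witness[where i = "\<lambda>r. r \<circ> inv_into UNIV s" and j = "\<lambda>q. q \<circ> s"])
    fix q assume q: "q \<in> col_stabilizer lam A (s \<circ> t)"
    then have qp: "q permutes A" by (simp add: col_stabilizer_def)
    show "q \<circ> s \<circ> inv_into UNIV s = q" using permutes_inv_o[OF s] by (simp add: comp_assoc)
    have qs: "q \<circ> s permutes A" using permutes_compose[OF s qp] .
    then show "q \<circ> s \<in> fiber (pat s)"
      using q s unfolding fiber_def col_stabilizer_def by (simp add: pat_eq_iff tab_col_comp image_comp)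
    show "?g (q \<circ> s) = (if tabloid (q \<circ> s) = T then of_int (sign q) else 0)"
      using sign_comp[OF qp s] by (simp add: mult.left_commute flip: of_int_mult)
  next
    fix r assume r: "r \<in> fiber (pat s)"
    then have rp: "r permutes A" and rs: "\<forall>j. r ` tab_col lam t j = s ` tab_col lam t j"
      using s pat_eq_iff[of r s] by (simp_all add: fiber_def)
    show "r \<circ> inv_into UNIV s \<circ> s = r" using permutes_inv_o[OF s] by (simp add: comp_assoc)
    have "(r \<circ> inv_into UNIV s) ` s ` X = r ` X" for X
      unfolding image_comp comp_assoc permutes_inv_o(2)[OF s] by simp
    then show "r \<circ> inv_into UNIV s \<in> col_stabilizer lam A (s \<circ> t)"
      using rs permutes_compose[OF inv rp] unfolding col_stabilizer_def tab_col_comp by simp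
  qed
  also have "\<dots> = of_int (sign s) * vec (pat s) T"
    unfolding vec_def alternating_sum_def sum_distrib_left by (rule sum.cong) auto
  finally show "polytabloid lam A (s \<circ> t) T = of_int (sign s) * vec (pat s) T" .
qed

lemma tableau_eq_relabelling:
  assumes u: "u \<in> tableaux lam A"
  obtains s where "s permutes A" "\<And>x. x \<in> young_diagram lam \<Longrightarrow> u x = (s \<circ> t) x"
proof -
  let ?ti = "inv_into (young_diagram lam) t"
  define s where "s = (\<lambda>a. if a \<in> A then u (?ti a) else a)"
  have "bij_betw (u \<circ> ?ti) A A"
    using bij_betw_trans[OF bij_betw_inv_into[OF t_bij]] u unfolding tableaux_def by simp
  then have "bij_betw s A A"
    by (rule bij_betw_cong[THEN iffD1, rotated]) (simp add: s_def)
  then have "s permutes A"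
    by (rule bij_imp_permutes) (simp add: s_def)
  moreover have "u x = (s \<circ> t) x" if "x \<in> young_diagram lam" for x
    using that t_bij unfolding s_def bij_betw_def by auto
  ultimately show ?thesis by (rule that)
qed

lemma polytabloid_cong:
  assumes "\<And>x. x \<in> young_diagram lam \<Longrightarrow> u x = w x"
  shows "polytabloid lam A u = polytabloid lam A w"
proof -
  have "tab_col lam u = tab_col lam w"
    unfolding tab_col_def using assms by (auto simp: fun_eq_iff) metis+
  moreover have "tab_row lam (q \<circ> u) = tab_row lam (q \<circ> w)" for q :: "'a \<Rightarrow> 'a"
    unfolding tab_row_def using assms by (auto simp: fun_eq_iff) metis+
  ultimately show ?thesis
    unfolding polytabloid_def col_stabilizer_def by simp
qed

lemma specht_module_eq_span:
  assumes I: "\<And>r. r permutes A \<Longrightarrow> pat r \<in> I"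
  shows "specht_module lam A = cfun.span (vec ` I)"
  unfolding specht_module_def
proof (rule cfun.span_eq[THEN iffD2], intro conjI subsetI)
  fix f assume "f \<in> polytabloid lam A ` tableaux lam A"
  then obtain u where u: "u \<in> tableaux lam A" "f = polytabloid lam A u" by auto
  obtain s where s: "s permutes A" "\<And>x. x \<in> young_diagram lam \<Longrightarrow> u x = (s \<circ> t) x"
    using tableau_eq_relabelling[OF u(1)] by blast
  have "f = (\<lambda>T. of_int (sign s) * vec (pat s) T)"
    unfolding u(2) polytabloid_comp[OF s(1), symmetric] by (rule polytabloid_cong) (rule s(2))
  then show "f \<in> cfun.span (vec ` I)"
    using I[OF s(1)] cfun.span_scale cfun.span_base by blast
next
  fix f assume "f \<in> vec ` I"
  then obtain i where i: "i \<in> I" "f = vec i" by auto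
  show "f \<in> cfun.span (polytabloid lam A ` tableaux lam A)"
  proof (cases "fiber i = {}")
    case True
    then have "f = 0" using i by (simp add: vec_def alternating_sum_def fun_eq_iff)
    then show ?thesis using cfun.span_zero by simp
  next
    case False
    then obtain s where s: "s permutes A" "pat s = i" unfolding fiber_def by auto
    have "f = (\<lambda>T. of_int (sign s) * polytabloid lam A (s \<circ> t) T)"
      unfolding polytabloid_comp[OF s(1)] s(2) i(2)
      by (simp add: fun_eq_iff sign_def)
    moreover have "s \<circ> t \<in> tableaux lam A"
      using bij_betw_trans[OF t_bij permutes_imp_bij[OF s(1)]] unfolding tableaux_def by simp
    ultimately show ?thesis
      using cfun.span_scale cfun.span_base by blast
  qed
qed

lemma sum_fiber_act:
  assumes s: "s permutes A"
  shows "(\<Sum>r\<in>fiber (act s i). g r) = (\<Sum>r\<in>fiber i. g (s \<circ> r))"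
proof (rule sum.reindex_bij_witness[where j = "\<lambda>r. inv_into UNIV s \<circ> r" and i = "\<lambda>r. s \<circ> r"])
  fix r assume "r \<in> fiber i"
  then have r: "r permutes A" "pat r = i" by (simp_all add: fiber_def)
  then show "s \<circ> r \<in> fiber (act s i)"
    using permutes_compose[OF r(1) s] pat_comp[OF s r(1)] by (simp add: fiber_def)
  show "inv_into UNIV s \<circ> (s \<circ> r) = r"
    unfolding comp_assoc[symmetric] permutes_inv_o(2)[OF s] by simp
next
  fix r assume r: "r \<in> fiber (act s i)"
  show eq: "s \<circ> (inv_into UNIV s \<circ> r) = r" "g (s \<circ> (inv_into UNIV s \<circ> r)) = g r"
    unfolding comp_assoc[symmetric] permutes_inv_o(1)[OF s] by simp_all
  have p: "inv_into UNIV s \<circ> r permutes A"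
    using r permutes_inv[OF s] by (auto simp: fiber_def permutes_compose)
  then have "act s (pat (inv_into UNIV s \<circ> r)) = act s i"
    using pat_comp[OF s p] eq r by (simp add: fiber_def)
  then have "pat (inv_into UNIV s \<circ> r) = i" by (rule act_inj[OF s])
  then show "inv_into UNIV s \<circ> r \<in> fiber i"
    using p by (simp add: fiber_def)
qed

text \<open>The sign in \<open>vec\<close> twists the action, which is why the conjugate partitions appear.\<close>
lemma tabloid_action_vec:
  assumes s: "s permutes A"
  shows "tabloid_action s (vec i) = (\<lambda>T. of_int (sign s) * vec (act s i) T)"
proof
  fix T
  have iff: "tabloid r = (\<lambda>k. inv_into UNIV s ` T k) \<longleftrightarrow> tabloid (s \<circ> r) = T" for r
  proof -
    have s_inv: "s ` inv_into UNIV s ` Y = Y" "inv_into UNIV s ` s ` Y = Y" for Y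
      unfolding image_comp permutes_inv_o[OF s] by simp_all
    have "(r ` X = inv_into UNIV s ` Y) = (s ` r ` X = Y)" for X Y
    proof
      assume "r ` X = inv_into UNIV s ` Y"
      then show "s ` r ` X = Y" by (simp only: s_inv)
    next
      assume "s ` r ` X = Y"
      then show "r ` X = inv_into UNIV s ` Y" using s_inv(2)[of "r ` X"] by (simp only:)
    qed
    then show ?thesis unfolding tab_row_comp fun_eq_iff image_comp[symmetric] by simp
  qed
  have "vec (act s i) T = (\<Sum>r\<in>fiber i. if tabloid (s \<circ> r) = T then of_int (sign (s \<circ> r)) else 0)"
    unfolding vec_def alternating_sum_def by (rule sum_fiber_act[OF s])
  also have "\<dots> = (\<Sum>r\<in>fiber i. if tabloid r = (\<lambda>k. inv_into UNIV s ` T k) then of_int (sign s) * of_int (sign r) else 0)"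
    by (rule sum.cong) (simp_all only: iff fiber_def mem_Collect_eq sign_comp[OF s] of_int_mult)
  also have "\<dots> = of_int (sign s) * tabloid_action s (vec i) T"
    unfolding vec_def alternating_sum_def tabloid_action_def sum_distrib_left by (rule sum.cong) auto
  finally show "tabloid_action s (vec i) T = of_int (sign s) * vec (act s i) T"
    by (simp add: sign_def split: if_splits)
qed

lemma gram_act:
  assumes s: "s permutes A"
  shows "gram (act s j) (act s i) = gram j i"
proof -
  have *: "vec (act s j) (tabloid (s \<circ> r)) = of_int (sign s) * vec j (tabloid r)" for r
  proof -
    have "inv_into UNIV s ` s ` X = X" for X
      unfolding image_comp permutes_inv_o(2)[OF s] by simp
    then have "(\<lambda>k. inv_into UNIV s ` tabloid (s \<circ> r) k) = tabloid r"
      unfolding tab_row_comp image_comp[symmetric] by simp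
    then have "of_int (sign s) * vec (act s j) (tabloid (s \<circ> r)) = vec j (tabloid r)"
      using fun_cong[OF tabloid_action_vec[OF s, of j], of "tabloid (s \<circ> r)"]
      by (simp add: tabloid_action_def)
    then show ?thesis by (auto simp add: sign_def minus_equation_iff split: if_splits)
  qed
  show ?thesis
    unfolding gram_def coef_def sum_fiber_act[OF s]
  proof (rule sum.cong)
    fix r assume "r \<in> fiber i"
    then have "sign (s \<circ> r) = sign s * sign r" by (simp add: sign_comp[OF s] fiber_def)
    then show "of_int (sign (s \<circ> r)) * vec (act s j) (tabloid (s \<circ> r))
        = of_int (sign r) * vec j (tabloid r)"
      unfolding * by (simp only:) (simp add: sign_def)
  qed simp
qed

text \<open>
  A row and a column of a tableau meet in at most one entry, so a permutation is determined by its
  column pattern and its tabloid. Hence the coefficients of \<open>vec i\<close> on its tabloids are signs, and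
  \<open>gram i i\<close> is the size of the fiber.
\<close>
lemma gram_self_nonzero:
  assumes "fiber i \<noteq> {}"
  shows "gram i i \<noteq> 0"
proof -
  have uniq: "r = s" if r: "r \<in> fiber i" and s: "s \<in> fiber i" and eq: "tabloid r = tabloid s" for r s
  proof
    fix a
    show "r a = s a"
    proof (cases "a \<in> A")
      case False
      then show ?thesis using r s by (simp add: fiber_def permutes_def)
    next
      case True
      then obtain k j where kj: "(k, j) \<in> young_diagram lam" "a = t (k, j)"
        using t_bij unfolding bij_betw_def by auto
      have rp: "r permutes A" and sp: "s permutes A" using r s by (auto simp: fiber_def)
      have "r a \<in> r ` tab_row lam t k"
        using kj unfolding tab_row_def by auto
      then have "r a \<in> s ` tab_row lam t k"
        using fun_cong[OF eq, of k] by (simp only: tab_row_comp)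
      moreover have "r a \<in> r ` tab_col lam t j"
        using kj unfolding tab_col_def by auto
      moreover have "r ` tab_col lam t j = s ` tab_col lam t j"
        using r s rp sp pat_eq_iff[of r s] by (simp add: fiber_def)
      ultimately have "r a \<in> s ` (tab_row lam t k \<inter> tab_col lam t j)"
        by (simp only: image_Int[OF permutes_inj[OF sp]] Int_iff)
      moreover have "tab_row lam t k \<inter> tab_col lam t j \<subseteq> {a}"
        using kj t_bij unfolding tab_row_def tab_col_def bij_betw_def by (auto dest: inj_onD)
      ultimately show ?thesis by auto
    qed
  qed
  have "vec i (tabloid r) = of_int (sign r)" if "r \<in> fiber i" for r
  proof -
    have "vec i (tabloid r) = (\<Sum>s\<in>fiber i. if s = r then of_int (sign s) else 0)"
      unfolding vec_def alternating_sum_def by (rule sum.cong) (use uniq that in auto)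
    then show ?thesis using that finite_fiber by simp
  qed
  then have "gram i i = of_nat (card (fiber i))"
    unfolding gram_def coef_def by (simp flip: of_int_mult)
  then show ?thesis using assms finite_fiber by simp
qed

lemma gram_unattained:
  assumes "fiber i = {} \<or> fiber j = {}"
  shows "gram j i = 0"
  using assms by (auto simp: gram_def coef_def vec_def alternating_sum_def)

lemma coef_add: "coef i (f + g) = coef i f + coef i g"
  unfolding coef_def by (simp add: distrib_left sum.distrib)

lemma coef_scale: "coef i (\<lambda>T. c * f T) = c * coef i f"
  unfolding coef_def sum_distrib_left by (rule sum.cong) auto

text \<open>
  Exchanging two entries of a row keeps the tabloid and reverses the sign. When \<open>S\<close> is closed under
  this exchange the sum is \<open>0\<close>. All linear relations between the \<open>vec i\<close> used below arise so.
\<close>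
lemma alternating_sum_row_swap:
  assumes ab: "(k, j) \<in> young_diagram lam" "(k, j') \<in> young_diagram lam" "j \<noteq> j'"
    and S: "\<And>r. r \<in> S \<Longrightarrow> r permutes A"
    and S': "S' = (\<lambda>r. r \<circ> transpose (t (k, j)) (t (k, j'))) ` S"
  shows "alternating_sum S' = - alternating_sum S"
proof
  fix T
  let ?tau = "transpose (t (k, j)) (t (k, j'))"
  have A: "t (k, j) \<in> A" "t (k, j') \<in> A"
    using ab t_bij unfolding bij_betw_def by auto
  have ne: "t (k, j) \<noteq> t (k, j')"
    using ab t_bij unfolding bij_betw_def inj_on_def by blast
  have tau: "?tau permutes A" using permutes_swap_id[OF A] .
  have row: "?tau ` tab_row lam t i = tab_row lam t i" for i
  proof -
    have "t (k, j) \<in> tab_row lam t i \<longleftrightarrow> i = k" if "(k, j) \<in> young_diagram lam" for j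
      using that t_bij unfolding tab_row_def bij_betw_def by (auto dest: inj_onD)
    then show ?thesis using ab by (simp add: transpose_image_eq)
  qed
  have tabl: "tabloid (r \<circ> ?tau) = tabloid r" for r
    unfolding tab_row_comp image_comp[symmetric] row ..
  have inj: "inj_on (\<lambda>r. r \<circ> ?tau) S"
    by (rule inj_onI) (metis comp_assoc comp_id transpose_comp_involutory)
  have "alternating_sum S' T = (\<Sum>r\<in>S. if tabloid r = T then of_int (sign (r \<circ> ?tau)) else 0)"
    unfolding alternating_sum_def S' sum.reindex[OF inj] by (simp add: tabl)
  also have "\<dots> = (\<Sum>r\<in>S. - (if tabloid r = T then of_int (sign r) else 0))"
    by (rule sum.cong) (auto simp: sign_comp S tau sign_swap_id ne)
  also have "\<dots> = - alternating_sum S T"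
    unfolding alternating_sum_def by (simp add: sum_negf)
  finally show "alternating_sum S' T = (- alternating_sum S) T" by simp
qed

text \<open>
  The hypothesis \<open>frame\<close> expresses that a Young symmetrizer is idempotent up to a factor. This
  factor is given by \<open>c\<close> and \<open>gram i i\<close>. Keeping the latter symbolic avoids counting the fiber.
\<close>
theorem sym_char_eq_gram_sum:
  assumes fin: "finite I" and I: "\<And>r. r permutes A \<Longrightarrow> pat r \<in> I"
    and act_I: "\<And>s i. s permutes A \<Longrightarrow> i \<in> I \<Longrightarrow> act s i \<in> I"
    and frame: "\<And>j. j \<in> I \<Longrightarrow> (\<Sum>i\<in>I. (\<lambda>T. (c * gram j i / gram i i) * vec i T)) = vec j"
    and s: "s permutes A"
  shows "sym_char lam A s = of_int (sign s) * (\<Sum>i\<in>I. c * gram (act s i) i / gram i i)"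
proof -
  define l where "l = (\<lambda>i f. c / gram i i * coef i f)"
  have span: "specht_module lam A = cfun.span (vec ` I)"
    using specht_module_eq_span[OF I] .
  have "sym_char lam A s = (\<Sum>i\<in>I. l i (tabloid_action s (vec i)))"
    unfolding sym_char_def
  proof (rule trace_on_frame[OF fin span])
    fix j assume j: "j \<in> I"
    show "tabloid_action s (vec j) \<in> specht_module lam A"
      unfolding span tabloid_action_vec[OF s]
      by (intro cfun.span_scale cfun.span_base imageI act_I s j)
    show "(\<Sum>i\<in>I. (\<lambda>x. l i (vec j) * vec i x)) = vec j"
      using frame[OF j] by (simp add: l_def gram_def)
  next
    show "l i (f + g) = l i f + l i g" for i f g
      unfolding l_def coef_add by (rule distrib_left)
  qed (auto simp: l_def coef_scale tabloid_action_def fun_eq_iff)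
  also have "\<dots> = (\<Sum>i\<in>I. of_int (sign s) * (c * gram (act s i) i / gram i i))"
    by (rule sum.cong) (auto simp: l_def tabloid_action_vec[OF s] coef_scale gram_def)
  finally show ?thesis by (simp add: sum_distrib_left)
qed

end

section \<open>Functions on three-element subsets\<close>

definition triples :: "'a set \<Rightarrow> 'a set set" where
  "triples A = {B. B \<subseteq> A \<and> card B = 3}"

definition pairs :: "'a set \<Rightarrow> 'a set set" where
  "pairs A = {P. P \<subseteq> A \<and> card P = 2}"

text \<open>
  \<open>pair_weight n k\<close> is the weight of a pair in a triple that it meets in \<open>k\<close> points. The values are
  forced by \<open>pair_weight_inverse\<close>: they give a left inverse of the map that sends a pair to the sum
  of the triples containing it.
\<close>
definition pair_weight :: "nat \<Rightarrow> nat \<Rightarrow> complex" where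
  "pair_weight n k =
     (if k = 2 then 1 / (of_nat n - 2)
      else if k = 1 then - 1 / ((of_nat n - 2) * (of_nat n - 3))
      else 2 / ((of_nat n - 2) * (of_nat n - 3) * (of_nat n - 4)))"

lemma finite_triples: "finite A \<Longrightarrow> finite (triples A)"
  unfolding triples_def by simp

lemma finite_pairs: "finite A \<Longrightarrow> finite (pairs A)"
  unfolding pairs_def by simp

text \<open>
  If \<open>P\<close> and \<open>Q\<close> have \<open>i\<close> points in common, then adding a point to \<open>Q\<close> produces an intersection of
  size \<open>i + 1\<close> in \<open>2 - i\<close> cases and one of size \<open>i\<close> in the other \<open>n - 4 + i\<close> cases.
\<close>
lemma pair_weight_inverse:
  assumes A: "finite A" "card A \<ge> 5" and P: "P \<in> pairs A" and Q: "Q \<in> pairs A"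
  shows "(\<Sum>x\<in>A - Q. pair_weight (card A) (card (P \<inter> insert x Q))) = (if P = Q then 1 else 0)"
proof -
  let ?n = "card A" and ?i = "card (P \<inter> Q)"
  have fin: "finite P" "finite Q" and PQ: "P \<subseteq> A" "Q \<subseteq> A" "card P = 2" "card Q = 2"
    using A P Q finite_subset unfolding pairs_def by auto
  have i_le: "?i \<le> 2"
    using card_mono[of P "P \<inter> Q"] fin PQ by auto
  have split: "A - Q = (P - Q) \<union> (A - (P \<union> Q))" using PQ by auto
  have c1: "card (P - Q) = 2 - ?i"
    using card_Diff_subset_Int[of P Q] fin PQ by simp
  have "card (P \<union> Q) + ?i = 4"
    using card_Un_Int[OF fin] PQ by simp
  then have c2: "card (A - (P \<union> Q)) = ?n - (4 - ?i)"
    using card_Diff_subset[of "P \<union> Q" A] fin PQ by simp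
  have "(\<Sum>x\<in>A - Q. pair_weight ?n (card (P \<inter> insert x Q)))
      = (\<Sum>x\<in>P - Q. pair_weight ?n (card (P \<inter> insert x Q)))
      + (\<Sum>x\<in>A - (P \<union> Q). pair_weight ?n (card (P \<inter> insert x Q)))"
    unfolding split by (rule sum.union_disjoint) (use A fin in auto)
  also have "\<dots> = (\<Sum>x\<in>P - Q. pair_weight ?n (?i + 1)) + (\<Sum>x\<in>A - (P \<union> Q). pair_weight ?n ?i)"
    using fin by (intro arg_cong2[where f = "(+)"] sum.cong) (auto simp: Int_insert_right)
  also have "\<dots> = of_nat (2 - ?i) * pair_weight ?n (?i + 1) + of_nat (?n - (4 - ?i)) * pair_weight ?n ?i"
    by (simp add: c1 c2)
  also have "\<dots> = (if P = Q then 1 else 0)"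
  proof -
    have eq_iff: "P = Q \<longleftrightarrow> ?i = 2"
      using fin PQ by (metis Int_absorb Int_lower1 Int_lower2 card_subset_eq)
    have ne: "(of_nat ?n :: complex) - 2 \<noteq> 0" "(of_nat ?n :: complex) - 3 \<noteq> 0" "(of_nat ?n :: complex) - 4 \<noteq> 0"
      using A(2) by (auto simp: complex_eq_iff)
    consider "?i = 0" | "?i = 1" | "?i = 2" using i_le by linarith
    then show ?thesis
    proof cases
      case 1
      then show ?thesis using ne A(2) eq_iff
        by (simp add: pair_weight_def of_nat_diff divide_simps)
    next
      case 2
      then show ?thesis using ne A(2) eq_iff
        by (simp add: pair_weight_def of_nat_diff divide_simps)
    next
      case 3
      then show ?thesis using ne A(2) eq_iff
        by (simp add: pair_weight_def of_nat_diff divide_simps)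
    qed
  qed
  finally show ?thesis .
qed

lemma sum_pairs_of_triples:
  assumes A: "finite A"
  shows "(\<Sum>B\<in>triples A. \<Sum>P\<in>{P. P \<subseteq> B \<and> card P = 2}. f P B)
       = (\<Sum>P\<in>pairs A. \<Sum>x\<in>A - P. f P (insert x P))"
proof -
  have "(\<Sum>B\<in>triples A. \<Sum>P\<in>{P. P \<subseteq> B \<and> card P = 2}. f P B)
      = (\<Sum>(B, P)\<in>(SIGMA B:triples A. {P. P \<subseteq> B \<and> card P = 2}). f P B)"
    by (rule sum.Sigma) (use A in \<open>auto simp: triples_def dest: finite_subset\<close>)
  also have "\<dots> = (\<Sum>(P, x)\<in>(SIGMA P:pairs A. A - P). f P (insert x P))"
  proof (rule sum.reindex_bij_witness[where i = "\<lambda>(P, x). (insert x P, P)"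
        and j = "\<lambda>(B, P). (P, the_elem (B - P))"])
    fix p assume p: "p \<in> (SIGMA B:triples A. {P. P \<subseteq> B \<and> card P = 2})"
    obtain B P where BP: "p = (B, P)" by (cases p)
    have B: "B \<subseteq> A" "card B = 3" "P \<subseteq> B" "card P = 2"
      using p unfolding BP triples_def by simp_all
    have "finite P" using A B(1,3) by (meson finite_subset)
    then have "card (B - P) = 1" using card_Diff_subset[of P B] B by simp
    then obtain x where x: "B - P = {x}" by (metis card_1_singletonE)
    then have "insert x P = B" "x \<in> A" "x \<notin> P" using B by blast+
    then show "(case case p of (B, P) \<Rightarrow> (P, the_elem (B - P)) of (P, x) \<Rightarrow> (insert x P, P)) = p"
      "(case p of (B, P) \<Rightarrow> (P, the_elem (B - P))) \<in> (SIGMA P:pairs A. A - P)"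
      "(case case p of (B, P) \<Rightarrow> (P, the_elem (B - P)) of (P, x) \<Rightarrow> f P (insert x P)) = (case p of (B, P) \<Rightarrow> f P B)"
      using B unfolding BP prod.case x the_elem_eq by (simp_all add: pairs_def)
  next
    fix q assume q: "q \<in> (SIGMA P:pairs A. A - P)"
    obtain P x where Px: "q = (P, x)" by (cases q)
    have P: "P \<subseteq> A" "card P = 2" "x \<in> A" "x \<notin> P"
      using q unfolding Px pairs_def by simp_all
    have "finite P" using A P(1) by (meson finite_subset)
    moreover have x: "insert x P - P = {x}" using P(4) by blast
    ultimately show "(case case q of (P, x) \<Rightarrow> (insert x P, P) of (B, P) \<Rightarrow> (P, the_elem (B - P))) = q"
      "(case q of (P, x) \<Rightarrow> (insert x P, P)) \<in> (SIGMA B:triples A. {P. P \<subseteq> B \<and> card P = 2})"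
      using P unfolding Px prod.case x the_elem_eq by (auto simp: triples_def)
  qed
  also have "\<dots> = (\<Sum>P\<in>pairs A. \<Sum>x\<in>A - P. f P (insert x P))"
    by (rule sum.Sigma[symmetric]) (use A in \<open>auto simp: finite_pairs\<close>)
  finally show ?thesis .
qed

text \<open>
  The projection of the space of functions on the 3-subsets onto the complement of the image of the
  functions on the 2-subsets, an element of the Bose-Mesner algebra of the Johnson scheme.
\<close>
definition johnson :: "nat \<Rightarrow> 'a set \<Rightarrow> 'a set \<Rightarrow> complex" where
  "johnson n B Y = (if B = Y then 1 else 0)
     - (\<Sum>P\<in>{P. P \<subseteq> Y \<and> card P = 2}. pair_weight n (card (P \<inter> B)))"

lemma johnson_self:
  assumes "card Y = 3"
  shows "johnson n Y Y = 1 - 3 * pair_weight n 2"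
proof -
  have fin: "finite Y" using assms by (simp add: card_ge_0_finite)
  have "(\<Sum>P\<in>{P. P \<subseteq> Y \<and> card P = 2}. pair_weight n (card (P \<inter> Y)))
      = (\<Sum>P\<in>{P. P \<subseteq> Y \<and> card P = 2}. pair_weight n 2)"
    by (rule sum.cong) (auto simp: Int_absorb2)
  also have "\<dots> = 3 * pair_weight n 2"
    using n_subsets[OF fin, of 2] assms by (simp add: numeral_eq_Suc)
  finally show ?thesis by (simp add: johnson_def)
qed

lemma johnson_sum:
  assumes A: "finite A" "card A \<ge> 5" and Y: "Y \<in> triples A" and Q: "Q \<in> pairs A"
  shows "(\<Sum>x\<in>A - Q. johnson (card A) (insert x Q) Y) = 0"
proof -
  let ?PY = "{P. P \<subseteq> Y \<and> card P = 2}"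
  have Y': "Y \<subseteq> A" "card Y = 3" "finite Y" using Y A finite_subset by (auto simp: triples_def)
  have Q': "Q \<subseteq> A" "card Q = 2" "finite Q" using Q A finite_subset by (auto simp: pairs_def)
  have "(\<Sum>x\<in>A - Q. if insert x Q = Y then 1 else 0) = (if Q \<subseteq> Y then 1 else (0::complex))"
  proof (cases "Q \<subseteq> Y")
    case True
    then have "card (Y - Q) = 1" using Y' Q' card_Diff_subset[of Q Y] by simp
    then obtain y where y: "Y - Q = {y}" by (auto simp: card_1_singleton_iff)
    then have "insert x Q = Y \<longleftrightarrow> x = y" if "x \<in> A - Q" for x using True that by auto
    then have "(\<Sum>x\<in>A - Q. if insert x Q = Y then 1 else 0) = (\<Sum>x\<in>A - Q. if x = y then 1 else (0::complex))"
      by (intro sum.cong) auto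
    also have "\<dots> = 1" using A y Y' by (auto simp: sum.delta)
    finally show ?thesis using True by simp
  next
    case False
    then show ?thesis by (auto intro!: sum.neutral)
  qed
  moreover have "(\<Sum>x\<in>A - Q. \<Sum>P\<in>?PY. pair_weight (card A) (card (P \<inter> insert x Q)))
      = (if Q \<subseteq> Y then 1 else 0)"
  proof -
    have "(\<Sum>x\<in>A - Q. \<Sum>P\<in>?PY. pair_weight (card A) (card (P \<inter> insert x Q)))
       = (\<Sum>P\<in>?PY. if P = Q then 1 else 0)"
    proof (subst sum.swap, rule sum.cong[OF refl])
      fix P assume "P \<in> ?PY"
      then have "P \<in> pairs A" using Y' by (auto simp: pairs_def)
      then show "(\<Sum>x\<in>A - Q. pair_weight (card A) (card (P \<inter> insert x Q))) = (if P = Q then 1 else 0)"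
        by (rule pair_weight_inverse[OF A _ Q])
    qed
    also have "\<dots> = (if Q \<subseteq> Y then 1 else 0)"
      using Y'(3) Q' by (simp add: sum.delta)
    finally show ?thesis .
  qed
  ultimately show ?thesis
    by (simp add: johnson_def sum_subtractf)
qed

lemma johnson_image:
  assumes s: "bij s" and fix_Y: "\<And>y. y \<in> Y \<Longrightarrow> s y = y"
  shows "johnson n (s ` B) Y = johnson n B Y"
proof -
  have inj: "inj s" using s by (rule bij_is_inj)
  have Y: "s ` P = P" if "P \<subseteq> Y" for P using that fix_Y by force
  have "s ` B = Y \<longleftrightarrow> B = Y" using Y[of Y] inj by (metis inj_image_eq_iff subset_refl)
  moreover have "card (P \<inter> s ` B) = card (P \<inter> B)" if "P \<subseteq> Y" for P
    using Y[OF that] inj by (metis card_image image_Int inj_on_subset subset_UNIV)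
  ultimately show ?thesis
    unfolding johnson_def by auto
qed

text \<open>
  Induction on the number of points of \<open>B\<close> outside \<open>Y\<close>. Remove such a point \<open>x\<close> from \<open>B\<close> and apply
  the linear relation to the remaining pair \<open>Q\<close>: completing \<open>Q\<close> inside \<open>Y\<close> gives \<open>0\<close> by induction,
  completing it outside \<open>Y\<close> always gives \<open>f B\<close> by symmetry. Applied to a
  difference, this shows that functions with these properties are determined by their value at \<open>Y\<close>.
\<close>
lemma vanishing_on_triples:
  fixes f :: "'a set \<Rightarrow> complex"
  assumes A: "finite A" and Y: "Y \<in> triples A"
    and sum0: "\<And>Q. Q \<in> pairs A \<Longrightarrow> (\<Sum>x\<in>A - Q. f (insert x Q)) = 0"
    and inv: "\<And>p q B. p \<in> A - Y \<Longrightarrow> q \<in> A - Y \<Longrightarrow> f (transpose p q ` B) = f B"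
    and fY: "f Y = 0"
  shows "B \<in> triples A \<Longrightarrow> f B = 0"
proof (induction "card (B - Y)" arbitrary: B rule: less_induct)
  case less
  have B: "B \<subseteq> A" "card B = 3" "finite B" using less.prems A finite_subset by (auto simp: triples_def)
  have Y': "Y \<subseteq> A" "card Y = 3" "finite Y" using Y A finite_subset by (auto simp: triples_def)
  show ?case
  proof (cases "B \<subseteq> Y")
    case True
    then have "B = Y" using card_subset_eq[of Y B] B Y' by simp
    then show ?thesis using fY by simp
  next
    case False
    then obtain x where x: "x \<in> B" "x \<notin> Y" by auto
    define Q where "Q = B - {x}"
    have Q: "Q \<in> pairs A" "insert x Q = B" "x \<notin> Q"
      using B x unfolding Q_def pairs_def by auto
    have finQ: "finite Q" using B by (simp add: Q_def)
    have "f (insert y Q) = 0" if y: "y \<in> Y - Q" for y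
    proof (rule less.hyps)
      have "insert y Q - Y \<subset> B - Y" using y x unfolding Q_def by auto
      then show "card (insert y Q - Y) < card (B - Y)" using B by (intro psubset_card_mono) auto
      show "insert y Q \<in> triples A" using y Q finQ Y' unfolding triples_def pairs_def by auto
    qed
    moreover have "f (insert y Q) = f B" if y: "y \<in> A - (Q \<union> Y)" for y
    proof -
      have "transpose x y ` B = insert y Q"
        using y Q(3) unfolding Q(2)[symmetric] image_insert
        by (auto simp: transpose_image_eq)
      then show ?thesis using inv[of x y B] y x B by auto
    qed
    moreover have "(\<Sum>y\<in>A - Q. f (insert y Q))
        = (\<Sum>y\<in>Y - Q. f (insert y Q)) + (\<Sum>y\<in>A - (Q \<union> Y). f (insert y Q))"
      by (subst sum.union_disjoint[symmetric]) (use A Y' in \<open>auto intro!: sum.cong\<close>)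
    ultimately have "of_nat (card (A - (Q \<union> Y))) * f B = 0"
      using sum0[OF Q(1)] by simp
    moreover have "x \<in> A - (Q \<union> Y)" using x Q(3) B by auto
    then have "card (A - (Q \<union> Y)) \<noteq> 0" using A by auto
    ultimately show ?thesis by simp
  qed
qed

section \<open>The character of shape (2,2,2,1,...,1)\<close>

lemma sum_fun_eval: "(\<Sum>i\<in>I. f i) x = (\<Sum>i\<in>I. f i x)"
  by (induction I rule: infinite_finite_induct) auto

lemma permutation_extending:
  assumes A: "finite A" and C: "C \<subseteq> A" and f: "inj_on f C" "f ` C \<subseteq> A"
  obtains r where "r permutes A" "\<And>c. c \<in> C \<Longrightarrow> r c = f c"
proof -
  have finC: "finite C" using A C finite_subset by blast
  have "card (A - C) = card (A - f ` C)"
    using A C f finC by (simp add: card_Diff_subset card_image)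
  then obtain g where g: "bij_betw g (A - C) (A - f ` C)"
    using A finite_same_card_bij[of "A - C" "A - f ` C"] by auto
  define r where "r = (\<lambda>a. if a \<in> C then f a else if a \<in> A then g a else a)"
  have "bij_betw r C (f ` C)"
    using f(1) by (simp add: r_def bij_betw_def cong: inj_on_cong)
  moreover have "bij_betw r (A - C) (A - f ` C)"
    using g by (rule bij_betw_cong[THEN iffD1, rotated]) (simp add: r_def)
  ultimately have "bij_betw r (C \<union> (A - C)) (f ` C \<union> (A - f ` C))"
    by (rule bij_betw_combine) auto
  moreover have "C \<union> (A - C) = A" "f ` C \<union> (A - f ` C) = A" using C f(2) by auto
  ultimately have "bij_betw r A A" by simp
  then have "r permutes A"
    by (rule bij_imp_permutes) (use C in \<open>auto simp: r_def\<close>)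
  then show thesis by (rule that) (simp add: r_def)
qed

text \<open>
  For this shape the columns of a tableau are determined by the three entries of the second one.
\<close>
definition shape222 :: "nat \<Rightarrow> nat list" where
  "shape222 n = [2, 2, 2] @ replicate (n - 6) 1"

lemma young_diagram_222:
  assumes "n \<ge> 7"
  shows "(i, j) \<in> young_diagram (shape222 n) \<longleftrightarrow> j = 0 \<and> i < n - 3 \<or> j = 1 \<and> i < 3"
proof -
  have "i < 3 \<Longrightarrow> shape222 n ! i = 2"
    by (auto simp: shape222_def nth_append less_Suc_eq numeral_3_eq_3 numeral_2_eq_2)
  moreover have "3 \<le> i \<Longrightarrow> i < n - 3 \<Longrightarrow> shape222 n ! i = 1"
    by (simp only: shape222_def nth_append) auto
  moreover have "length (shape222 n) = n - 3" using assms by (simp add: shape222_def)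
  ultimately show ?thesis
    using assms unfolding young_diagram_def by (cases "i < 3") auto
qed

locale tableau222 =
  fixes A :: "'a set" and n :: nat and t :: "nat \<times> nat \<Rightarrow> 'a"
  assumes A: "finite A" "card A = n" and n: "n \<ge> 7" and t: "t \<in> tableaux (shape222 n) A"
begin

definition C :: "'a set" where "C = t ` ({..<3} \<times> {1})"

lemma t_inj: "inj_on t (young_diagram (shape222 n))"
  and t_image: "t ` young_diagram (shape222 n) = A"
  using t unfolding tableaux_def bij_betw_def by auto

lemma C: "C \<subseteq> A" "card C = 3"
proof -
  have sub: "{..<3} \<times> {1} \<subseteq> young_diagram (shape222 n)"
    using n by (auto simp: young_diagram_222)
  then show "C \<subseteq> A" unfolding C_def t_image[symmetric] by auto
  show "card C = 3"
    unfolding C_def by (subst card_image) (use t_inj sub inj_on_subset in \<open>auto simp: card_cartesian_product\<close>)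
qed

lemma columns: "tab_col (shape222 n) t j = (if j = 0 then A - C else if j = 1 then C else {})"
proof -
  have "tab_col (shape222 n) t 0 = A - C"
  proof -
    have "t (i, 0) \<notin> C" if "i < n - 3" for i
      using t_inj that n by (auto simp: C_def young_diagram_222 dest!: inj_onD)
    moreover have "\<exists>i<n - 3. a = t (i, 0)" if a: "a \<in> A" "a \<notin> C" for a
    proof -
      obtain i j where "(i, j) \<in> young_diagram (shape222 n)" "a = t (i, j)"
        using a(1) unfolding t_image[symmetric] by auto
      then show ?thesis using a(2) n by (auto simp: C_def young_diagram_222)
    qed
    moreover have "t (i, 0) \<in> A" if "i < n - 3" for i
      unfolding t_image[symmetric] using that n by (auto simp: young_diagram_222)
    ultimately show ?thesis
      using n by (auto simp: tab_col_def young_diagram_222)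
  qed
  moreover have "tab_col (shape222 n) t 1 = C"
    using n by (auto simp: tab_col_def young_diagram_222 C_def)
  moreover have "tab_col (shape222 n) t j = {}" if "j \<noteq> 0" "j \<noteq> 1"
    using n that by (auto simp: tab_col_def young_diagram_222)
  ultimately show ?thesis by auto
qed

sublocale column_pattern "shape222 n" A t "\<lambda>r. r ` C" "\<lambda>s B. s ` B"
proof
  fix r s assume r: "r permutes A" and s: "s permutes A"
  have "r ` (A - C) = A - r ` C" if "r permutes A" for r
    using that C(1) permutes_inj[OF that] permutes_image[OF that] by (simp add: image_set_diff)
  then have "r ` tab_col (shape222 n) t j = s ` tab_col (shape222 n) t j" if "r ` C = s ` C" for j
    using r s that by (simp add: columns)
  moreover have "r ` C = s ` C" if "\<forall>j. r ` tab_col (shape222 n) t j = s ` tab_col (shape222 n) t j"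
    using that[rule_format, of 1] by (simp add: columns)
  ultimately show "r ` C = s ` C \<longleftrightarrow> (\<forall>j. r ` tab_col (shape222 n) t j = s ` tab_col (shape222 n) t j)"
    by (intro iffI allI)
next
  fix s :: "'a \<Rightarrow> 'a" and i j assume "s permutes A" "s ` i = s ` j"
  then show "i = j" by (simp add: inj_image_eq_iff[OF permutes_inj])
qed (use A t in \<open>auto simp: image_comp\<close>)

lemma fiber_triple:
  assumes B: "B \<in> triples A"
  shows "fiber B \<noteq> {}"
proof -
  have B': "B \<subseteq> A" "card B = 3" "finite B" using B A(1) finite_subset by (auto simp: triples_def)
  have "finite C" using C A(1) finite_subset by blast
  then obtain f where f: "bij_betw f C B" using finite_same_card_bij[of C B] C B' by auto
  then obtain r where "r permutes A" "\<And>c. c \<in> C \<Longrightarrow> r c = f c"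
    using permutation_extending[OF A(1) C(1), of f] B' unfolding bij_betw_def by metis
  moreover from this have "r ` C = B" using f unfolding bij_betw_def by auto
  ultimately show ?thesis unfolding fiber_def by auto
qed

text \<open>
  Prescribing the entries of the second column in two of the first three rows leaves the third
  of these rows free, so that its two entries can be exchanged.
\<close>
lemma alternating_sum_pair:
  assumes k: "k < 3"
  shows "alternating_sum {r. r permutes A \<and> r ` (C - {t (k, 1)}) = Q} = 0"
proof -
  let ?tau = "transpose (t (k, 0)) (t (k, 1))"
  let ?S = "{r. r permutes A \<and> r ` (C - {t (k, 1)}) = Q}"
  have cells: "(k, 0) \<in> young_diagram (shape222 n)" "(k, 1) \<in> young_diagram (shape222 n)"
    using k n by (auto simp: young_diagram_222)
  have "t (k, 0) \<notin> C"
    using columns[of 0] cells unfolding tab_col_def by auto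
  then have fix_C: "?tau c = c" if "c \<in> C - {t (k, 1)}" for c
    using that by (auto simp: transpose_def)
  have tau: "?tau permutes A"
    using cells t_image by (intro permutes_swap_id) auto
  have closed: "r \<circ> ?tau \<in> ?S" if "r \<in> ?S" for r
  proof -
    have "(r \<circ> ?tau) ` (C - {t (k, 1)}) = r ` (C - {t (k, 1)})"
      by (rule image_cong) (simp_all only: fix_C comp_apply)
    then show ?thesis using that permutes_compose[OF tau] by simp
  qed
  have "(\<lambda>r. r \<circ> ?tau) ` ?S = ?S"
  proof (intro subset_antisym subsetI)
    fix r assume "r \<in> ?S"
    then have "r \<circ> ?tau \<in> ?S" by (rule closed)
    moreover have "r = (r \<circ> ?tau) \<circ> ?tau" by (simp add: comp_assoc)
    ultimately show "r \<in> (\<lambda>r. r \<circ> ?tau) ` ?S" by blast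
  next
    fix r assume "r \<in> (\<lambda>r. r \<circ> ?tau) ` ?S"
    then obtain q where "q \<in> ?S" "r = q \<circ> ?tau" by blast
    then show "r \<in> ?S" using closed[of q] by simp
  qed
  then have "alternating_sum ?S = - alternating_sum ?S"
    using alternating_sum_row_swap[OF cells, of ?S ?S] by auto
  then show ?thesis by (simp add: fun_eq_iff)
qed

text \<open>
  A Garnir relation. A permutation \<open>r\<close> occurs on the left if \<open>Q \<subseteq> r ` C\<close>. These are sorted by the
  position \<open>u\<close> in \<open>C\<close> whose entry is not in \<open>Q\<close>, and each class cancels by itself.
\<close>
lemma sum_vec_pair:
  assumes Q: "Q \<in> pairs A"
  shows "(\<Sum>x\<in>A - Q. vec (insert x Q) T) = 0"
proof -
  let ?g = "\<lambda>r. if tabloid r = T then of_int (sign r) else (0::complex)"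
  let ?U = "{r. r permutes A \<and> Q \<subseteq> r ` C}"
  let ?S = "\<lambda>u. {r. r permutes A \<and> r ` (C - {u}) = Q}"
  have Q': "Q \<subseteq> A" "card Q = 2" "finite Q" using Q A(1) finite_subset by (auto simp: pairs_def)
  have finC: "finite C" using C A(1) finite_subset by blast
  have inj: "inj_on r C" if "r permutes A" for r using permutes_inj_on[OF that] .
  have "(\<Sum>x\<in>A - Q. vec (insert x Q) T) = (\<Sum>r\<in>(\<Union>x\<in>A - Q. fiber (insert x Q)). ?g r)"
    unfolding vec_def alternating_sum_def
    by (rule sum.UNION_disjoint[symmetric]) (use A(1) finite_fiber in \<open>auto simp: fiber_def\<close>)
  also have "(\<Union>x\<in>A - Q. fiber (insert x Q)) = ?U"
  proof (intro subset_antisym subsetI)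
    fix r assume r: "r \<in> ?U"
    then have "card (r ` C) = 3" "r ` C \<subseteq> A"
      using card_image[OF inj] C permutes_image by (auto dest: permutes_in_image)
    then have "card (r ` C - Q) = 1" using r Q' by (simp add: card_Diff_subset)
    then obtain x where x: "r ` C - Q = {x}" by (auto simp: card_1_singleton_iff)
    then have "r ` C = insert x Q" "x \<in> A - Q" using r \<open>r ` C \<subseteq> A\<close> by auto
    then show "r \<in> (\<Union>x\<in>A - Q. fiber (insert x Q))" using r unfolding fiber_def by auto
  qed (auto simp: fiber_def)
  also have "?U = (\<Union>u\<in>C. ?S u)"
  proof (intro subset_antisym subsetI)
    fix r assume r: "r \<in> ?U"
    then have "card (r ` C) = 3" using card_image[OF inj] C by auto
    then have "card (r ` C - Q) = 1" using r Q' by (simp add: card_Diff_subset)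
    then obtain x where x: "r ` C - Q = {x}" by (auto simp: card_1_singleton_iff)
    then obtain u where u: "u \<in> C" "x = r u" by auto
    have "r ` (C - {u}) = r ` C - {r u}"
      using inj[of r] r u by (subst inj_on_image_set_diff[of r C]) auto
    also have "\<dots> = Q" using x u r by auto
    finally show "r \<in> (\<Union>u\<in>C. ?S u)" using r u by auto
  qed auto
  also have "(\<Sum>r\<in>(\<Union>u\<in>C. ?S u). ?g r) = (\<Sum>u\<in>C. \<Sum>r\<in>?S u. ?g r)"
  proof (rule sum.UNION_disjoint[OF finC])
    show "\<forall>u\<in>C. finite (?S u)"
      using finite_permutations[OF A(1)] by (auto intro: finite_subset)
    have "u = w" if "u \<in> C" "w \<in> C" "r permutes A" "r ` (C - {u}) = r ` (C - {w})" for u w r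
    proof -
      have "C - {u} = C - {w}"
        using that permutes_inj[OF that(3)] by (simp add: inj_image_eq_iff)
      then show ?thesis using that by auto
    qed
    then show "\<forall>u\<in>C. \<forall>w\<in>C. u \<noteq> w \<longrightarrow> ?S u \<inter> ?S w = {}" by blast
  qed
  also have "\<dots> = 0"
  proof (rule sum.neutral, rule ballI)
    fix u assume "u \<in> C"
    then obtain k where "k < 3" "u = t (k, 1)" by (auto simp: C_def)
    then show "(\<Sum>r\<in>?S u. ?g r) = 0"
      using fun_cong[OF alternating_sum_pair[of k Q], of T] by (simp add: alternating_sum_def)
  qed
  finally show ?thesis .
qed

text \<open>
  Both sides are annihilated by the pair relations, are invariant under permutations outside \<open>Y\<close>, and
  agree at \<open>B = Y\<close>.
\<close>
lemma gram_eq_johnson: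
  assumes B: "B \<in> triples A" and Y: "Y \<in> triples A"
  shows "(1 - 3 * pair_weight n 2) * gram B Y / gram Y Y = johnson n B Y"
proof -
  let ?k = "1 - 3 * pair_weight n 2"
  have Y': "Y \<subseteq> A" "card Y = 3" using Y by (auto simp: triples_def)
  have gram_ne: "gram Y Y \<noteq> 0" by (rule gram_self_nonzero[OF fiber_triple[OF Y]])
  have "?k / gram Y Y * gram B Y - johnson n B Y = 0"
  proof (rule vanishing_on_triples[OF A(1) Y _ _ _ B])
    fix Q assume Q: "Q \<in> pairs A"
    have "(\<Sum>x\<in>A - Q. gram (insert x Q) Y) = 0"
      unfolding gram_def coef_def
      by (subst sum.swap) (simp add: sum_vec_pair[OF Q] flip: sum_distrib_left)
    moreover have "(\<Sum>x\<in>A - Q. johnson n (insert x Q) Y) = 0"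
      using johnson_sum[OF A(1) _ Y Q] A(2) n by simp
    ultimately show "(\<Sum>x\<in>A - Q. ?k / gram Y Y * gram (insert x Q) Y - johnson n (insert x Q) Y) = 0"
      unfolding sum_subtractf sum_distrib_left[symmetric] by simp
  next
    fix p q B assume pq: "p \<in> A - Y" "q \<in> A - Y"
    let ?s = "transpose p q"
    have s: "?s permutes A" using pq by (intro permutes_swap_id) auto
    have fix_Y: "?s y = y" if "y \<in> Y" for y using that pq by (auto simp: transpose_def)
    then have "?s ` Y = Y" by force
    then have "gram (?s ` B) Y = gram B Y" using gram_act[OF s, of B Y] by simp
    moreover have "johnson n (?s ` B) Y = johnson n B Y"
      by (rule johnson_image) (use fix_Y in auto)
    ultimately show "?k / gram Y Y * gram (?s ` B) Y - johnson n (?s ` B) Y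
        = ?k / gram Y Y * gram B Y - johnson n B Y" by simp
  next
    show "?k / gram Y Y * gram Y Y - johnson n Y Y = 0"
      using gram_ne johnson_self[OF Y'(2)] by simp
  qed
  then show ?thesis by simp
qed

lemma johnson_frame:
  assumes B: "B \<in> triples A"
  shows "(\<Sum>Y\<in>triples A. johnson n B Y * vec Y T) = vec B T"
proof -
  have "(\<Sum>Y\<in>triples A. johnson n B Y * vec Y T)
      = (\<Sum>Y\<in>triples A. if B = Y then vec Y T else 0)
        - (\<Sum>Y\<in>triples A. \<Sum>P\<in>{P. P \<subseteq> Y \<and> card P = 2}. pair_weight n (card (P \<inter> B)) * vec Y T)"
    unfolding sum_subtractf[symmetric]
  proof (rule sum.cong[OF refl])
    fix Y
    show "johnson n B Y * vec Y T = (if B = Y then vec Y T else 0)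
        - (\<Sum>P\<in>{P. P \<subseteq> Y \<and> card P = 2}. pair_weight n (card (P \<inter> B)) * vec Y T)"
      unfolding johnson_def left_diff_distrib sum_distrib_right by simp
  qed
  also have "(\<Sum>Y\<in>triples A. \<Sum>P\<in>{P. P \<subseteq> Y \<and> card P = 2}. pair_weight n (card (P \<inter> B)) * vec Y T) = 0"
    unfolding sum_pairs_of_triples[OF A(1)]
  proof (rule sum.neutral, rule ballI)
    fix P assume "P \<in> pairs A"
    then show "(\<Sum>x\<in>A - P. pair_weight n (card (P \<inter> B)) * vec (insert x P) T) = 0"
      unfolding sum_distrib_left[symmetric] by (simp add: sum_vec_pair)
  qed
  also have "(\<Sum>Y\<in>triples A. if B = Y then vec Y T else 0) = vec B T"
    using B finite_triples[OF A(1)] by simp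
  finally show ?thesis by simp
qed

lemma sym_char_eq_johnson_sum:
  assumes s: "s permutes A"
  shows "sym_char (shape222 n) A s = of_int (sign s) * (\<Sum>B\<in>triples A. johnson n (s ` B) B)"
proof -
  let ?k = "1 - 3 * pair_weight n 2"
  have image_triple: "r ` B \<in> triples A" if "r permutes A" "B \<in> triples A" for r B
    using that card_image[OF permutes_inj_on[OF that(1), of B]] permutes_in_image[OF that(1)]
    by (auto simp: triples_def)
  have C_triple: "C \<in> triples A" using C by (simp add: triples_def)
  have "sym_char (shape222 n) A s
      = of_int (sign s) * (\<Sum>B\<in>triples A. ?k * gram (s ` B) B / gram B B)"
  proof (rule sym_char_eq_gram_sum[OF finite_triples[OF A(1)] _ _ _ s])
    fix B assume B: "B \<in> triples A"
    have "(\<Sum>Y\<in>triples A. (\<lambda>T. ?k * gram B Y / gram Y Y * vec Y T))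
        = (\<Sum>Y\<in>triples A. (\<lambda>T. johnson n B Y * vec Y T))"
      by (rule sum.cong) (simp_all add: gram_eq_johnson[OF B])
    also have "\<dots> = vec B"
      using johnson_frame[OF B] by (simp add: fun_eq_iff sum_fun_eval)
    finally show "(\<Sum>Y\<in>triples A. (\<lambda>T. ?k * gram B Y / gram Y Y * vec Y T)) = vec B" .
  qed (use image_triple C_triple in auto)
  also have "(\<Sum>B\<in>triples A. ?k * gram (s ` B) B / gram B B) = (\<Sum>B\<in>triples A. johnson n (s ` B) B)"
    by (rule sum.cong) (use gram_eq_johnson image_triple[OF s] in auto)
  finally show ?thesis .
qed

end

text \<open>
  The subtracted part of \<open>johnson\<close> factors through the functions on pairs, where the opposite
  composition is the identity. So it contributes the trace of \<open>s\<close> on the functions on pairs.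
\<close>
lemma johnson_trace:
  assumes A: "finite A" "card A = n" "n \<ge> 5" and s: "s permutes A"
  shows "(\<Sum>B\<in>triples A. johnson n (s ` B) B)
       = of_nat (card {B \<in> triples A. s ` B = B}) - of_nat (card {P \<in> pairs A. s ` P = P})"
proof -
  have "(\<Sum>B\<in>triples A. \<Sum>P\<in>{P. P \<subseteq> B \<and> card P = 2}. pair_weight n (card (P \<inter> s ` B)))
      = (\<Sum>P\<in>pairs A. if s ` P = P then 1 else 0)"
    unfolding sum_pairs_of_triples[OF A(1)]
  proof (rule sum.cong[OF refl])
    fix P assume P: "P \<in> pairs A"
    have sP: "s ` P \<in> pairs A"
      using P card_image[OF permutes_inj_on[OF s, of P]] permutes_in_image[OF s] by (auto simp: pairs_def)
    have "(\<Sum>x\<in>A - P. pair_weight n (card (P \<inter> s ` insert x P)))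
        = (\<Sum>y\<in>s ` (A - P). pair_weight n (card (P \<inter> insert y (s ` P))))"
      by (subst sum.reindex[OF permutes_inj_on[OF s]]) simp
    also have "s ` (A - P) = A - s ` P"
      using permutes_inj[OF s] permutes_image[OF s] by (simp add: image_set_diff)
    also have "(\<Sum>y\<in>A - s ` P. pair_weight n (card (P \<inter> insert y (s ` P)))) = (if s ` P = P then 1 else 0)"
      using pair_weight_inverse[OF A(1) _ P sP] A by auto
    finally show "(\<Sum>x\<in>A - P. pair_weight n (card (P \<inter> s ` insert x P))) = (if s ` P = P then 1 else 0)" .
  qed
  moreover have "(\<Sum>P\<in>pairs A. if s ` P = P then 1 else 0) = (of_nat (card {P \<in> pairs A. s ` P = P}) :: complex)"
    using finite_pairs[OF A(1)] by (simp add: sum.If_cases Collect_conj_eq)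
  moreover have "(\<Sum>B\<in>triples A. if s ` B = B then 1 else 0) = (of_nat (card {B \<in> triples A. s ` B = B}) :: complex)"
    using finite_triples[OF A(1)] by (simp add: sum.If_cases Collect_conj_eq)
  ultimately show ?thesis
    unfolding johnson_def sum_subtractf by simp
qed

theorem sym_char_222:
  fixes A :: "'a set"
  assumes A: "finite A" "card A = n" and n: "n \<ge> 7" and s: "s permutes A"
  shows "sym_char (shape222 n) A s = of_int (sign s) *
    (of_nat (card {B \<in> triples A. s ` B = B}) - of_nat (card {P \<in> pairs A. s ` P = P}))"
proof -
  have "sum_list (shape222 n) = n" using n by (simp add: shape222_def sum_list_replicate)
  then obtain t where "t \<in> tableaux (shape222 n) A"
    using tableau_ex[OF A(1), of "shape222 n"] A(2) by auto
  then interpret tableau222 A n t using A n by unfold_locales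
  show ?thesis
    using sym_char_eq_johnson_sum[OF s] johnson_trace[OF A _ s] n by simp
qed

section \<open>The character of shape (4,1,...,1)\<close>

text \<open>
  For a hook with arm of length 3 the columns of a tableau are determined by the ordered triple of
  the arm entries, and the spanning vectors alternate in it. Below, \<open>delta_det3 x y z u v w\<close> is the
  coordinate of \<open>x \<and> y \<and> z\<close> at \<open>(u, v, w)\<close>.
\<close>
definition delta :: "'a \<Rightarrow> 'a \<Rightarrow> complex" where
  "delta a b = (if a = b then 1 else 0)"

definition delta_det3 :: "'a \<Rightarrow> 'a \<Rightarrow> 'a \<Rightarrow> 'a \<Rightarrow> 'a \<Rightarrow> 'a \<Rightarrow> complex" where
  "delta_det3 x y z u v w =
     delta x u * delta y v * delta z w + delta x v * delta y w * delta z u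
     + delta x w * delta y u * delta z v - delta x v * delta y u * delta z w
     - delta x w * delta y v * delta z u - delta x u * delta y w * delta z v"

definition delta_det2 :: "'a \<Rightarrow> 'a \<Rightarrow> 'a \<Rightarrow> 'a \<Rightarrow> complex" where
  "delta_det2 y z v w = delta y v * delta z w - delta y w * delta z v"

text \<open>The coordinate of \<open>s \<and> y \<and> z\<close> at \<open>(u, v, w)\<close>, where \<open>s\<close> is the sum of all points.\<close>
definition delta_minors :: "'a \<Rightarrow> 'a \<Rightarrow> 'a \<Rightarrow> 'a \<Rightarrow> 'a \<Rightarrow> complex" where
  "delta_minors y z u v w = delta_det2 y z v w + delta_det2 y z w u + delta_det2 y z u v"

text \<open>
  The projection of the exterior cube along \<open>s \<and> \<Lambda>\<^sup>2\<close>, with \<open>s\<close> the sum of all points, so that the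
  image is the exterior cube of the reflection representation. The factor \<open>1/6\<close> compensates for
  summing over ordered triples.
\<close>
definition wedge_proj :: "nat \<Rightarrow> 'a \<Rightarrow> 'a \<Rightarrow> 'a \<Rightarrow> 'a \<Rightarrow> 'a \<Rightarrow> 'a \<Rightarrow> complex" where
  "wedge_proj n x y z u v w = (delta_det3 x y z u v w
     - (delta_minors y z u v w + delta_minors z x u v w + delta_minors x y u v w) / of_nat n) / 6"

lemma sum_delta:
  assumes "finite A" "u \<in> A"
  shows "(\<Sum>a\<in>A. delta a u * f a) = f u" "(\<Sum>a\<in>A. delta u a * f a) = f u"
  using assms unfolding delta_def by (simp_all add: if_distrib[of "\<lambda>c. c * _"] cong: if_cong)

lemma sum_delta1:
  assumes "finite A" "u \<in> A"
  shows "(\<Sum>a\<in>A. delta a u) = 1" "(\<Sum>a\<in>A. delta u a) = 1"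
  using assms unfolding delta_def by simp_all

lemma sum_delta_det3:
  assumes A: "finite A" and uvw: "u \<in> A" "v \<in> A" "w \<in> A"
  shows "(\<Sum>a\<in>A. delta_det3 a y z u v w) = delta_minors y z u v w"
proof -
  have "(\<Sum>a\<in>A. delta_det3 a y z u v w)
    = (\<Sum>a\<in>A. delta a u * delta_det2 y z v w + delta a v * delta_det2 y z w u + delta a w * delta_det2 y z u v)"
    by (rule sum.cong) (simp_all add: delta_det3_def delta_det2_def algebra_simps)
  then show ?thesis
    using A uvw by (simp add: sum.distrib sum_delta delta_minors_def)
qed

lemma sum_delta_minors:
  assumes A: "finite A" and uvw: "u \<in> A" "v \<in> A" "w \<in> A"
  shows "(\<Sum>a\<in>A. delta_minors a z u v w) = 0" "(\<Sum>a\<in>A. delta_minors z a u v w) = 0"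
  using A uvw
  by (simp_all add: delta_minors_def delta_det2_def sum.distrib sum_subtractf sum_delta1
      flip: sum_distrib_left sum_distrib_right)

lemma delta_minors_swap: "delta_minors z y u v w = - delta_minors y z u v w"
  unfolding delta_minors_def delta_det2_def by (simp add: algebra_simps)

lemma delta_det3_swap:
  "delta_det3 y x z u v w = - delta_det3 x y z u v w"
  "delta_det3 x z y u v w = - delta_det3 x y z u v w"
  unfolding delta_det3_def by (simp_all add: algebra_simps)

lemma wedge_proj_swap12: "wedge_proj n y x z u v w = - wedge_proj n x y z u v w"
  unfolding wedge_proj_def delta_det3_swap(1)[of y x] delta_minors_swap[of y x]
    delta_minors_swap[of x z] delta_minors_swap[of z y]
  by (simp add: diff_divide_distrib add_divide_distrib)

lemma wedge_proj_swap23: "wedge_proj n x z y u v w = - wedge_proj n x y z u v w"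
  unfolding wedge_proj_def delta_det3_swap(2)[of x z] delta_minors_swap[of y x]
    delta_minors_swap[of x z] delta_minors_swap[of z y]
  by (simp add: diff_divide_distrib add_divide_distrib)

lemma wedge_proj_repeated:
  assumes "u = v \<or> v = w \<or> u = w"
  shows "wedge_proj n x y z u v w = 0"
  using assms unfolding wedge_proj_def delta_det3_def delta_minors_def delta_det2_def
  by auto

lemma wedge_proj_sum:
  assumes A: "finite A" "card A = n" "n > 0" and uvw: "u \<in> A" "v \<in> A" "w \<in> A"
  shows "(\<Sum>x\<in>A. wedge_proj n x y z u v w) = 0"
  using A uvw
  by (simp add: wedge_proj_def sum_subtractf sum.distrib sum_delta_det3 sum_delta_minors
      flip: sum_divide_distrib)

lemma wedge_proj_self:
  assumes "u \<noteq> v" "v \<noteq> w" "u \<noteq> w" "n > 0"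
  shows "wedge_proj n u v w u v w = (1 - 3 / of_nat n) / 6"
  using assms by (simp add: wedge_proj_def delta_det3_def delta_minors_def delta_det2_def delta_def)

lemma wedge_proj_image:
  assumes s: "inj s" and fix_uvw: "s u = u" "s v = v" "s w = w"
  shows "wedge_proj n (s x) (s y) (s z) u v w = wedge_proj n x y z u v w"
proof -
  have "delta (s a) b = delta a b" if "b \<in> {u, v, w}" for a b
    using that fix_uvw injD[OF s] unfolding delta_def by (metis empty_iff insert_iff)
  then show ?thesis
    unfolding wedge_proj_def delta_det3_def delta_minors_def delta_det2_def by simp
qed

text \<open>
  If two arguments lie outside \<open>{u, v, w}\<close>, exchanging them changes the sign of \<open>f\<close> but also leaves
  \<open>f\<close> invariant. If one does, the linear relation in that argument contains only equal terms
  besides zeros.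
\<close>
lemma vanishing_alternating:
  fixes f :: "'a \<Rightarrow> 'a \<Rightarrow> 'a \<Rightarrow> complex"
  assumes A: "finite A" and uvw: "u \<in> A" "v \<in> A" "w \<in> A"
    and swap12: "\<And>x y z. f y x z = - f x y z"
    and swap23: "\<And>x y z. f x z y = - f x y z"
    and sum0: "\<And>y z. y \<in> A \<Longrightarrow> z \<in> A \<Longrightarrow> (\<Sum>x\<in>A. f x y z) = 0"
    and inv: "\<And>p q x y z. p \<in> A - {u, v, w} \<Longrightarrow> q \<in> A - {u, v, w} \<Longrightarrow>
      f (transpose p q x) (transpose p q y) (transpose p q z) = f x y z"
    and f0: "f u v w = 0"
    and xyz: "x \<in> A" "y \<in> A" "z \<in> A"
  shows "f x y z = 0"
proof -
  let ?Y = "{u, v, w}"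
  have eq12: "f a a b = 0" and eq23: "f b a a = 0" for a b
    using swap12[of a a b] swap23[of b a a] by simp_all
  have eq13: "f a b a = 0" for a b
    using swap12[of a b a] eq23[of b a] by simp
  have inside: "f a b c = 0" if "a \<in> ?Y" "b \<in> ?Y" "c \<in> ?Y" for a b c
  proof -
    have "f v u w = 0" "f u w v = 0" "f v w u = 0" "f w u v = 0" "f w v u = 0"
      using f0 swap12[of u v w] swap23[of u v w] swap23[of v u w] swap12[of u w v] swap12[of v w u]
      by (metis neg_equal_0_iff_equal)+
    then show ?thesis using that f0 eq12 eq23 eq13 by blast
  qed
  have two_outside: "f a b c = 0" if ab: "a \<in> A - ?Y" "b \<in> A - ?Y" for a b c
  proof (cases "a = b \<or> a = c \<or> b = c")
    case True
    then show ?thesis using eq12 eq23 eq13 by blast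
  next
    case False
    then have "f b a c = f a b c"
      using inv[OF ab, of a b c] by auto
    then show ?thesis using swap12[of a b c] by simp
  qed
  have one_outside: "f a b c = 0" if abc: "a \<in> A - ?Y" "b \<in> ?Y" "c \<in> ?Y" for a b c
  proof -
    have "f e b c = f a b c" if e: "e \<in> A - ?Y" for e
      using inv[OF abc(1) e, of a b c] abc e by (auto simp: transpose_def)
    then have "(\<Sum>e\<in>A - ?Y. f e b c) = of_nat (card (A - ?Y)) * f a b c" by simp
    moreover have "(\<Sum>e\<in>?Y. f e b c) = 0"
      by (rule sum.neutral) (use inside abc in blast)
    moreover have "(\<Sum>e\<in>A. f e b c) = (\<Sum>e\<in>A - ?Y. f e b c) + (\<Sum>e\<in>?Y. f e b c)"
      by (rule sum.subset_diff) (use A uvw in auto)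
    moreover have "(\<Sum>e\<in>A. f e b c) = 0" by (rule sum0) (use abc uvw in auto)
    moreover have "card (A - ?Y) \<noteq> 0" using abc A by auto
    ultimately show ?thesis by simp
  qed
  consider "x \<in> ?Y" "y \<in> ?Y" "z \<in> ?Y" | "x \<in> A - ?Y" "y \<in> A - ?Y" | "x \<in> A - ?Y" "z \<in> A - ?Y"
    | "y \<in> A - ?Y" "z \<in> A - ?Y" | "x \<in> A - ?Y" "y \<in> ?Y" "z \<in> ?Y" | "y \<in> A - ?Y" "x \<in> ?Y" "z \<in> ?Y"
    | "z \<in> A - ?Y" "x \<in> ?Y" "y \<in> ?Y"
    using xyz by blast
  then show ?thesis
  proof cases
    case 1
    then show ?thesis by (rule inside)
  next
    case 2
    then show ?thesis by (rule two_outside)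
  next
    case 3
    then have "f x z y = 0" by (rule two_outside)
    then show ?thesis using swap23[of x z y] by simp
  next
    case 4
    then have "f y z x = 0" by (rule two_outside)
    then show ?thesis using swap23[of y z x] swap12[of y x z] by simp
  next
    case 5
    then show ?thesis by (rule one_outside)
  next
    case 6
    then have "f y x z = 0" by (rule one_outside)
    then show ?thesis using swap12[of y x z] by simp
  next
    case 7
    then have "f z x y = 0" by (rule one_outside)
    then show ?thesis using swap12[of z x y] swap23[of x z y] by simp
  qed
qed

definition hook4 :: "nat \<Rightarrow> nat list" where
  "hook4 n = 4 # replicate (n - 4) 1"

lemma young_diagram_hook4:
  assumes "n \<ge> 5"
  shows "(i, j) \<in> young_diagram (hook4 n) \<longleftrightarrow> i = 0 \<and> j < 4 \<or> j = 0 \<and> i < n - 3"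
  using assms unfolding young_diagram_def hook4_def by (cases i) auto

definition act3 :: "('a \<Rightarrow> 'a) \<Rightarrow> 'a \<times> 'a \<times> 'a \<Rightarrow> 'a \<times> 'a \<times> 'a" where
  "act3 s = map_prod s (map_prod s s)"

lemma act3_simp [simp]: "act3 s (x, y, z) = (s x, s y, s z)"
  by (simp add: act3_def)

locale tableau_hook4 =
  fixes A :: "'a set" and n :: nat and t :: "nat \<times> nat \<Rightarrow> 'a"
  assumes A: "finite A" "card A = n" and n: "n \<ge> 5" and t: "t \<in> tableaux (hook4 n) A"
begin

definition arm :: "('a \<Rightarrow> 'a) \<Rightarrow> 'a \<times> 'a \<times> 'a" where
  "arm r = (r (t (0, 1)), r (t (0, 2)), r (t (0, 3)))"

lemma t_inj: "inj_on t (young_diagram (hook4 n))"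
  and t_image: "t ` young_diagram (hook4 n) = A"
  using t unfolding tableaux_def bij_betw_def by auto

lemma arm_cells: "j < 4 \<Longrightarrow> (0, j) \<in> young_diagram (hook4 n)"
  using n by (simp add: young_diagram_hook4)

lemma arm_in: "j < 4 \<Longrightarrow> t (0, j) \<in> A"
  using arm_cells t_image by blast

lemma arm_eq_iff: "i < 4 \<Longrightarrow> j < 4 \<Longrightarrow> t (0, i) = t (0, j) \<longleftrightarrow> i = j"
  using inj_onD[OF t_inj _ arm_cells arm_cells] by auto

lemma columns: "tab_col (hook4 n) t j =
  (if j = 0 then A - {t (0, 1), t (0, 2), t (0, 3)} else if j < 4 then {t (0, j)} else {})"
proof -
  have leg: "tab_col (hook4 n) t 0 = {t (i, 0) | i. i < n - 3}"
  proof -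
    have "(i, 0) \<in> young_diagram (hook4 n) \<longleftrightarrow> i < n - 3" for i
      using n by (auto simp: young_diagram_hook4)
    then show ?thesis unfolding tab_col_def by simp
  qed
  have "tab_col (hook4 n) t 0 = A - {t (0, 1), t (0, 2), t (0, 3)}"
  proof (intro subset_antisym subsetI)
    fix a assume "a \<in> tab_col (hook4 n) t 0"
    then obtain i where i: "a = t (i, 0)" "(i, 0) \<in> young_diagram (hook4 n)"
      unfolding tab_col_def by auto
    have "t (i, 0) \<noteq> t (0, j)" if "0 < j" "j < 4" for j
      using inj_onD[OF t_inj _ i(2) arm_cells[OF that(2)]] that(1) by auto
    then show "a \<in> A - {t (0, 1), t (0, 2), t (0, 3)}"
      using i t_image by auto
  next
    fix a assume a: "a \<in> A - {t (0, 1), t (0, 2), t (0, 3)}"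
    then obtain i j where ij: "(i, j) \<in> young_diagram (hook4 n)" "a = t (i, j)"
      unfolding t_image[symmetric] by auto
    then have "i = 0 \<and> j < 4 \<or> j = 0 \<and> i < n - 3" using n by (simp add: young_diagram_hook4)
    moreover have "j = 0 \<or> j = 1 \<or> j = 2 \<or> j = 3" if "j < 4" using that by linarith
    moreover have "0 < n - 3" using n by simp
    ultimately consider "j = 0" "i < n - 3" | "i = 0" "j \<in> {1, 2, 3}" by auto
    then show "a \<in> tab_col (hook4 n) t 0" unfolding leg using a ij(2) by cases auto
  qed
  then show ?thesis using n by (auto simp: tab_col_def young_diagram_hook4)
qed

sublocale column_pattern "hook4 n" A t arm act3
proof
  fix r s assume r: "r permutes A" and s: "s permutes A"
  let ?X = "{t (0, 1), t (0, 2), t (0, 3)}"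
  have "r ` (A - ?X) = A - r ` ?X" if "r permutes A" for r
    using that permutes_inj[OF that] permutes_image[OF that] by (simp add: image_set_diff)
  then have "r ` tab_col (hook4 n) t j = s ` tab_col (hook4 n) t j" if "arm r = arm s" for j
    using r s that by (auto simp: arm_def columns less_Suc_eq numeral_eq_Suc)
  moreover have "arm r = arm s" if "\<forall>j. r ` tab_col (hook4 n) t j = s ` tab_col (hook4 n) t j"
    using that[rule_format, of 1] that[rule_format, of 2] that[rule_format, of 3] by (simp add: arm_def columns)
  ultimately show "arm r = arm s \<longleftrightarrow> (\<forall>j. r ` tab_col (hook4 n) t j = s ` tab_col (hook4 n) t j)"
    by (intro iffI allI)
next
  fix s :: "'a \<Rightarrow> 'a" and i j assume "s permutes A" "act3 s i = act3 s j"
  then show "i = j"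
    by (cases i, cases j) (auto dest: permutes_inj injD)
qed (use A t in \<open>auto simp: arm_def\<close>)

lemma fiber_distinct:
  assumes uvw: "u \<in> A" "v \<in> A" "w \<in> A" and d: "u \<noteq> v" "v \<noteq> w" "u \<noteq> w"
  shows "fiber (u, v, w) \<noteq> {}"
proof -
  let ?f = "\<lambda>a. if a = t (0, 1) then u else if a = t (0, 2) then v else w"
  have ne: "t (0, 1) \<noteq> t (0, 2)" "t (0, 1) \<noteq> t (0, 3)" "t (0, 2) \<noteq> t (0, 3)"
    by (simp_all add: arm_eq_iff)
  obtain r where "r permutes A" "\<And>c. c \<in> {t (0, 1), t (0, 2), t (0, 3)} \<Longrightarrow> r c = ?f c"
  proof (rule permutation_extending[OF A(1), of "{t (0, 1), t (0, 2), t (0, 3)}" ?f])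
    show "{t (0, 1), t (0, 2), t (0, 3)} \<subseteq> A" by (auto intro: arm_in)
    show "inj_on ?f {t (0, 1), t (0, 2), t (0, 3)}" using ne d by (auto simp: inj_on_def)
    show "?f ` {t (0, 1), t (0, 2), t (0, 3)} \<subseteq> A" using uvw by auto
  qed blast
  then have "r \<in> fiber (u, v, w)" using ne by (auto simp: fiber_def arm_def)
  then show ?thesis by blast
qed

lemma fiber_repeated:
  assumes "u = v \<or> v = w \<or> u = w"
  shows "fiber (u, v, w) = {}"
proof -
  have ne: "t (0, 1) \<noteq> t (0, 2)" "t (0, 1) \<noteq> t (0, 3)" "t (0, 2) \<noteq> t (0, 3)"
    by (simp_all add: arm_eq_iff)
  have "r (t (0, 1)) \<noteq> r (t (0, 2)) \<and> r (t (0, 1)) \<noteq> r (t (0, 3)) \<and> r (t (0, 2)) \<noteq> r (t (0, 3))"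
    if "r permutes A" for r
    using ne permutes_inj[OF that] by (simp add: inj_eq)
  then show ?thesis using assms unfolding fiber_def arm_def by auto
qed

lemma alternating_sum_arm_swap:
  assumes ij: "i < 4" "j < 4" "i \<noteq> j"
    and S: "\<And>r. r permutes A \<Longrightarrow> r \<in> S \<longleftrightarrow> P r"
    and S': "\<And>r. r permutes A \<Longrightarrow> r \<in> S' \<longleftrightarrow> P (r \<circ> transpose (t (0, i)) (t (0, j)))"
    and sub: "S \<subseteq> {r. r permutes A}" "S' \<subseteq> {r. r permutes A}"
  shows "alternating_sum S' = - alternating_sum S"
proof (rule alternating_sum_row_swap[OF arm_cells[OF ij(1)] arm_cells[OF ij(2)] ij(3)])
  let ?tau = "transpose (t (0, i)) (t (0, j))"
  have tau: "?tau permutes A" using arm_in ij by (intro permutes_swap_id) auto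
  have tau2: "r \<circ> ?tau \<circ> ?tau = r" for r :: "'a \<Rightarrow> 'a" by (simp add: comp_assoc)
  show "S' = (\<lambda>r. r \<circ> ?tau) ` S"
  proof (intro subset_antisym subsetI)
    fix r assume "r \<in> S'"
    then have "r permutes A" "P (r \<circ> ?tau)" using S' sub by auto
    then have "r \<circ> ?tau \<in> S" using S permutes_compose[OF tau] by blast
    then show "r \<in> (\<lambda>r. r \<circ> ?tau) ` S" using tau2[of r] by (metis imageI)
  next
    fix r assume "r \<in> (\<lambda>r. r \<circ> ?tau) ` S"
    then obtain q where q: "q \<in> S" "r = q \<circ> ?tau" by auto
    then have "q permutes A" "P q" using S sub by auto
    then show "r \<in> S'" using S'[of r] q(2) tau2[of q] permutes_compose[OF tau, of q] by simp
  qed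
qed (use sub in auto)

lemma vec_swap12: "vec (y, x, z) = - vec (x, y, z)"
  unfolding vec_def
  by (rule alternating_sum_arm_swap[where i = 1 and j = 2 and P = "\<lambda>r. arm r = (x, y, z)"])
    (auto simp: fiber_def arm_def transpose_def arm_eq_iff)

lemma vec_swap23: "vec (x, z, y) = - vec (x, y, z)"
  unfolding vec_def
  by (rule alternating_sum_arm_swap[where i = 2 and j = 3 and P = "\<lambda>r. arm r = (x, y, z)"])
    (auto simp: fiber_def arm_def transpose_def arm_eq_iff)

text \<open>The corner and the first cell of the arm can be exchanged when the latter is unconstrained.\<close>
lemma sum_vec: "(\<Sum>x\<in>A. vec (x, y, z) T) = 0"
proof -
  let ?g = "\<lambda>r. if tabloid r = T then of_int (sign r) else (0::complex)"
  let ?S = "{r. r permutes A \<and> r (t (0, 2)) = y \<and> r (t (0, 3)) = z}"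
  have "alternating_sum ?S = - alternating_sum ?S"
    by (rule alternating_sum_arm_swap[where i = 0 and j = 1 and P = "\<lambda>r. r (t (0, 2)) = y \<and> r (t (0, 3)) = z"])
      (auto simp: transpose_def arm_eq_iff)
  then have zero: "alternating_sum ?S T = 0" by (simp add: fun_eq_iff)
  have "(\<Sum>x\<in>A. vec (x, y, z) T) = (\<Sum>r\<in>(\<Union>x\<in>A. fiber (x, y, z)). ?g r)"
    unfolding vec_def alternating_sum_def
    by (rule sum.UNION_disjoint[symmetric]) (use A(1) finite_fiber in \<open>auto simp: fiber_def arm_def\<close>)
  also have "(\<Union>x\<in>A. fiber (x, y, z)) = ?S"
    using arm_in[of 1] by (auto simp: fiber_def arm_def permutes_in_image)
  finally show ?thesis using zero unfolding alternating_sum_def by (rule trans)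
qed

text \<open>
  Both sides satisfy the hypotheses of \<open>vanishing_alternating\<close> and agree at \<open>(u, v, w)\<close>. For
  repeated entries both are \<open>0\<close>, the left one through \<open>gram (u, v, w) (u, v, w) = 0\<close> and division by
  zero.
\<close>
lemma gram_eq_wedge_proj:
  assumes xyz: "x \<in> A" "y \<in> A" "z \<in> A" and uvw: "u \<in> A" "v \<in> A" "w \<in> A"
  shows "(1 - 3 / of_nat n) / 6 * gram (x, y, z) (u, v, w) / gram (u, v, w) (u, v, w)
       = wedge_proj n x y z u v w"
proof (cases "u = v \<or> v = w \<or> u = w")
  case True
  then show ?thesis by (simp add: wedge_proj_repeated gram_unattained fiber_repeated)
next
  case False
  then have d: "u \<noteq> v" "v \<noteq> w" "u \<noteq> w" by auto
  let ?Y = "(u, v, w)"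
  let ?k = "(1 - 3 / of_nat n) / 6 / gram ?Y ?Y"
  have gram_ne: "gram ?Y ?Y \<noteq> 0" by (rule gram_self_nonzero[OF fiber_distinct[OF uvw d]])
  have "?k * gram (x, y, z) ?Y - wedge_proj n x y z u v w = 0"
  proof (rule vanishing_alternating[OF A(1) uvw _ _ _ _ _ xyz])
    show "?k * gram (b, a, c) ?Y - wedge_proj n b a c u v w
        = - (?k * gram (a, b, c) ?Y - wedge_proj n a b c u v w)" for a b c
      unfolding gram_def coef_def vec_swap12[of b a c] wedge_proj_swap12[of n b a c]
      by (simp add: sum_negf)
    show "?k * gram (a, c, b) ?Y - wedge_proj n a c b u v w
        = - (?k * gram (a, b, c) ?Y - wedge_proj n a b c u v w)" for a b c
      unfolding gram_def coef_def vec_swap23[of a c b] wedge_proj_swap23[of n a c b]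
      by (simp add: sum_negf)
  next
    fix b c assume "b \<in> A" "c \<in> A"
    have "(\<Sum>a\<in>A. gram (a, b, c) ?Y) = 0"
      unfolding gram_def coef_def
      by (subst sum.swap) (simp add: sum_vec flip: sum_distrib_left)
    moreover have "(\<Sum>a\<in>A. wedge_proj n a b c u v w) = 0"
      using wedge_proj_sum[OF A _ uvw] n by simp
    ultimately show "(\<Sum>a\<in>A. ?k * gram (a, b, c) ?Y - wedge_proj n a b c u v w) = 0"
      unfolding sum_subtractf sum_distrib_left[symmetric] by simp
  next
    fix p q a b c assume pq: "p \<in> A - {u, v, w}" "q \<in> A - {u, v, w}"
    let ?s = "transpose p q"
    have s: "?s permutes A" using pq by (intro permutes_swap_id) auto
    have fix_Y: "?s u = u" "?s v = v" "?s w = w" using pq by (auto simp: transpose_def)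
    then have "gram (?s a, ?s b, ?s c) ?Y = gram (a, b, c) ?Y"
      using gram_act[OF s, of "(a, b, c)" ?Y] by simp
    moreover have "wedge_proj n (?s a) (?s b) (?s c) u v w = wedge_proj n a b c u v w"
      by (rule wedge_proj_image) (use fix_Y in auto)
    ultimately show "?k * gram (?s a, ?s b, ?s c) ?Y - wedge_proj n (?s a) (?s b) (?s c) u v w
        = ?k * gram (a, b, c) ?Y - wedge_proj n a b c u v w" by simp
  next
    show "?k * gram ?Y ?Y - wedge_proj n u v w u v w = 0"
      using gram_ne wedge_proj_self[OF d] n by simp
  qed
  then show ?thesis by simp
qed

lemma sum_delta_det3_vec:
  assumes xyz: "x \<in> A" "y \<in> A" "z \<in> A"
  shows "(\<Sum>u\<in>A. \<Sum>v\<in>A. \<Sum>w\<in>A. delta_det3 x y z u v w * vec (u, v, w) T) = 6 * vec (x, y, z) T"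
proof -
  have *: "vec (y, x, z) T = - vec (x, y, z) T" "vec (x, z, y) T = - vec (x, y, z) T" for x y z
    by (simp_all add: vec_swap12[of y x z] vec_swap23[of x z y])
  have collapse: "(\<Sum>u\<in>A. \<Sum>v\<in>A. \<Sum>w\<in>A. delta a u * (delta b v * (delta c w * g u v w))) = g a b c"
    if "a \<in> A" "b \<in> A" "c \<in> A" for a b c and g :: "'a \<Rightarrow> 'a \<Rightarrow> 'a \<Rightarrow> complex"
    using that A(1) by (simp add: sum_delta flip: sum_distrib_left)
  have "delta_det3 x y z u v w * vec (u, v, w) T
      = delta x u * (delta y v * (delta z w * vec (u, v, w) T))
      + delta z u * (delta x v * (delta y w * vec (u, v, w) T))
      + delta y u * (delta z v * (delta x w * vec (u, v, w) T))
      - delta y u * (delta x v * (delta z w * vec (u, v, w) T))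
      - delta z u * (delta y v * (delta x w * vec (u, v, w) T))
      - delta x u * (delta z v * (delta y w * vec (u, v, w) T))" for u v w
    by (simp add: delta_det3_def algebra_simps)
  then have "(\<Sum>u\<in>A. \<Sum>v\<in>A. \<Sum>w\<in>A. delta_det3 x y z u v w * vec (u, v, w) T)
      = vec (x, y, z) T + vec (z, x, y) T + vec (y, z, x) T
        - vec (y, x, z) T - vec (z, y, x) T - vec (x, z, y) T"
    using xyz by (simp only: sum.distrib sum_subtractf collapse)
  then show ?thesis
    using *(1)[of x z y] *(2)[of x y z] *(2)[of y x z] *(1)[of x y z] *(1)[of y z x]
    by simp
qed

lemma wedge_frame:
  assumes xyz: "x \<in> A" "y \<in> A" "z \<in> A"
  shows "(\<Sum>u\<in>A. \<Sum>v\<in>A. \<Sum>w\<in>A. wedge_proj n x y z u v w * vec (u, v, w) T) = vec (x, y, z) T"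
proof -
  let ?S = "\<lambda>g. \<Sum>u\<in>A. \<Sum>v\<in>A. \<Sum>w\<in>A. g u v w * vec (u, v, w) T"
  have minors: "?S (delta_minors b c) = 0" if bc: "b \<in> A" "c \<in> A" for b c
  proof -
    have "?S (delta_minors b c)
        = (\<Sum>u\<in>A. \<Sum>v\<in>A. \<Sum>w\<in>A. \<Sum>a\<in>A. delta_det3 a b c u v w * vec (u, v, w) T)"
      by (intro sum.cong refl) (simp add: sum_delta_det3[OF A(1), symmetric] sum_distrib_right)
    also have "\<dots> = (\<Sum>u\<in>A. \<Sum>v\<in>A. \<Sum>a\<in>A. \<Sum>w\<in>A. delta_det3 a b c u v w * vec (u, v, w) T)"
      by (rule sum.cong[OF refl], rule sum.cong[OF refl], rule sum.swap)
    also have "\<dots> = (\<Sum>u\<in>A. \<Sum>a\<in>A. \<Sum>v\<in>A. \<Sum>w\<in>A. delta_det3 a b c u v w * vec (u, v, w) T)"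
      by (rule sum.cong[OF refl], rule sum.swap)
    also have "\<dots> = (\<Sum>a\<in>A. ?S (delta_det3 a b c))"
      by (rule sum.swap)
    also have "\<dots> = (\<Sum>a\<in>A. 6 * vec (a, b, c) T)"
      by (rule sum.cong) (use sum_delta_det3_vec bc in auto)
    also have "\<dots> = 0" by (simp add: sum_vec flip: sum_distrib_left)
    finally show ?thesis .
  qed
  have "wedge_proj n x y z u v w * vec (u, v, w) T
      = 1 / 6 * (delta_det3 x y z u v w * vec (u, v, w) T)
        - 1 / (6 * of_nat n) * (delta_minors y z u v w * vec (u, v, w) T)
        - 1 / (6 * of_nat n) * (delta_minors z x u v w * vec (u, v, w) T)
        - 1 / (6 * of_nat n) * (delta_minors x y u v w * vec (u, v, w) T)" for u v w
    by (simp add: wedge_proj_def algebra_simps add_divide_distrib diff_divide_distrib)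
  then have "?S (wedge_proj n x y z) = 1 / 6 * ?S (delta_det3 x y z)
        - 1 / (6 * of_nat n) * ?S (delta_minors y z) - 1 / (6 * of_nat n) * ?S (delta_minors z x)
        - 1 / (6 * of_nat n) * ?S (delta_minors x y)"
    by (simp only: sum_subtractf sum_distrib_left)
  then show ?thesis
    using xyz by (simp add: minors sum_delta_det3_vec)
qed

lemma sym_char_eq_wedge_sum:
  assumes s: "s permutes A"
  shows "sym_char (hook4 n) A s
    = of_int (sign s) * (\<Sum>x\<in>A. \<Sum>y\<in>A. \<Sum>z\<in>A. wedge_proj n (s x) (s y) (s z) x y z)"
proof -
  let ?k = "(1 - 3 / of_nat n) / 6 :: complex"
  let ?I = "A \<times> A \<times> A"
  have "sym_char (hook4 n) A s
      = of_int (sign s) * (\<Sum>i\<in>?I. ?k * gram (act3 s i) i / gram i i)"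
  proof (rule sym_char_eq_gram_sum[OF _ _ _ _ s])
    fix i assume "i \<in> ?I"
    then obtain x y z where i: "i = (x, y, z)" and xyz: "x \<in> A" "y \<in> A" "z \<in> A" by auto
    have "(\<Sum>j\<in>?I. ?k * gram i j / gram j j * vec j T)
       = (\<Sum>j\<in>?I. case j of (u, v, w) \<Rightarrow> wedge_proj n x y z u v w * vec (u, v, w) T)" for T
    proof (rule sum.cong[OF refl])
      fix j assume "j \<in> ?I"
      then obtain u v w where j: "j = (u, v, w)" and uvw: "u \<in> A" "v \<in> A" "w \<in> A" by auto
      show "?k * gram i j / gram j j * vec j T
          = (case j of (u, v, w) \<Rightarrow> wedge_proj n x y z u v w * vec (u, v, w) T)"
        unfolding i j prod.case gram_eq_wedge_proj[OF xyz uvw] ..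
    qed
    then show "(\<Sum>j\<in>?I. (\<lambda>T. ?k * gram i j / gram j j * vec j T)) = vec i"
      using wedge_frame[OF xyz]
      by (simp add: fun_eq_iff sum_fun_eval i flip: sum.cartesian_product)
  qed (use A in \<open>auto simp: arm_def arm_in permutes_in_image\<close>)
  also have "(\<Sum>i\<in>?I. ?k * gram (act3 s i) i / gram i i)
      = (\<Sum>(x, y, z)\<in>?I. wedge_proj n (s x) (s y) (s z) x y z)"
  proof (rule sum.cong[OF refl])
    fix i assume "i \<in> ?I"
    then obtain x y z where i: "i = (x, y, z)" and xyz: "x \<in> A" "y \<in> A" "z \<in> A" by auto
    then have sxyz: "s x \<in> A" "s y \<in> A" "s z \<in> A" using permutes_in_image[OF s] by auto
    show "?k * gram (act3 s i) i / gram i i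
        = (case i of (x, y, z) \<Rightarrow> wedge_proj n (s x) (s y) (s z) x y z)"
      unfolding i prod.case act3_simp gram_eq_wedge_proj[OF sxyz xyz] ..
  qed
  finally show ?thesis by (simp flip: sum.cartesian_product)
qed

end

theorem sym_char_hook4:
  fixes A :: "'a set"
  assumes A: "finite A" "card A = n" and n: "n \<ge> 5" and s: "s permutes A"
  shows "sym_char (hook4 n) A s = of_int (sign s) *
    (\<Sum>x\<in>A. \<Sum>y\<in>A. \<Sum>z\<in>A. wedge_proj n (s x) (s y) (s z) x y z)"
proof -
  have "sum_list (hook4 n) = n" using n by (simp add: hook4_def sum_list_replicate)
  then obtain t where "t \<in> tableaux (hook4 n) A"
    using tableau_ex[OF A(1), of "hook4 n"] A(2) by auto
  then interpret tableau_hook4 A n t using A n by unfold_locales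
  show ?thesis by (rule sym_char_eq_wedge_sum[OF s])
qed

section \<open>The difference of the two characters\<close>

definition fixed_count :: "'a set \<Rightarrow> ('a \<Rightarrow> 'a) \<Rightarrow> int" where
  "fixed_count A s = (\<Sum>x\<in>A. if s x = x then 1 else 0)"

text \<open>Every 2-cycle is counted twice.\<close>
definition swapped_count :: "'a set \<Rightarrow> ('a \<Rightarrow> 'a) \<Rightarrow> int" where
  "swapped_count A s = (\<Sum>x\<in>A. \<Sum>y\<in>A. if x \<noteq> y \<and> s x = y \<and> s y = x then 1 else 0)"

lemma card_orderings_of_triple:
  assumes "card B = 3"
  shows "card {(x, y, z). distinct [x, y, z] \<and> {x, y, z} = B} = 6"
proof -
  obtain a b c where B: "B = {a, b, c}" "a \<noteq> b" "b \<noteq> c" "a \<noteq> c"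
    using assms by (auto simp: card_3_iff)
  have "{(x, y, z). distinct [x, y, z] \<and> {x, y, z} = B}
      = {(a, b, c), (a, c, b), (b, a, c), (b, c, a), (c, a, b), (c, b, a)}"
    (is "?L = ?R")
  proof (intro subset_antisym subsetI)
    fix p assume "p \<in> ?L"
    then obtain x y z where p: "p = (x, y, z)" and d: "x \<noteq> y" "y \<noteq> z" "x \<noteq> z" and eq: "{x, y, z} = B"
      by auto
    have "x \<in> {a, b, c}" "y \<in> {a, b, c}" "z \<in> {a, b, c}"
      unfolding B(1)[symmetric] eq[symmetric] by simp_all
    then show "p \<in> ?R" unfolding p using d by (elim insertE emptyE) simp_all
  next
    fix p assume "p \<in> ?R"
    then show "p \<in> ?L" using B(2-4) unfolding B(1) by (elim insertE emptyE) (simp_all add: insert_commute)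
  qed
  then show ?thesis using B(2-4) by simp
qed

lemma sum_ordered_triples:
  assumes A: "finite A"
  shows "(\<Sum>x\<in>A. \<Sum>y\<in>A. \<Sum>z\<in>A. if distinct [x, y, z] \<and> P {x, y, z} then 1 else (0::complex))
       = 6 * of_nat (card {B \<in> triples A. P B})"
proof -
  let ?F = "{B \<in> triples A. P B}"
  let ?S = "\<lambda>B. {(x, y, z). distinct [x, y, z] \<and> {x, y, z} = B}"
  let ?Q = "\<lambda>(x, y, z). distinct [x, y, z] \<and> P {x, y, z}"
  have "(\<Sum>x\<in>A. \<Sum>y\<in>A. \<Sum>z\<in>A. if distinct [x, y, z] \<and> P {x, y, z} then 1 else (0::complex))
      = (\<Sum>t\<in>A \<times> A \<times> A. if ?Q t then 1 else 0)"
    unfolding sum.cartesian_product by (rule sum.cong[OF refl]) (simp add: case_prod_unfold)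
  also have "\<dots> = of_nat (card {t \<in> A \<times> A \<times> A. ?Q t})"
    by (subst sum.inter_filter[symmetric]) (use A in simp_all)
  also have "{t \<in> A \<times> A \<times> A. ?Q t} = (\<Union>B\<in>?F. ?S B)"
  proof (rule Set.set_eqI)
    fix t :: "'a \<times> 'a \<times> 'a"
    obtain x y z where t: "t = (x, y, z)" by (cases t)
    have "distinct [x, y, z] \<Longrightarrow> card {x, y, z} = 3" by simp
    then show "t \<in> {t \<in> A \<times> A \<times> A. ?Q t} \<longleftrightarrow> t \<in> (\<Union>B\<in>?F. ?S B)"
      unfolding t triples_def by auto
  qed
  also have "card (\<Union>B\<in>?F. ?S B) = (\<Sum>B\<in>?F. card (?S B))"
  proof (rule card_UN_disjoint)
    show "finite ?F" using finite_triples[OF A] by simp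
    show "\<forall>B\<in>?F. finite (?S B)"
    proof
      fix B assume "B \<in> ?F"
      then have "card (?S B) = 6" by (intro card_orderings_of_triple) (simp add: triples_def)
      then show "finite (?S B)" by (intro card_ge_0_finite) linarith
    qed
  qed auto
  also have "\<dots> = (\<Sum>B\<in>?F. 6)"
    by (rule sum.cong[OF refl], rule card_orderings_of_triple) (simp add: triples_def)
  finally show ?thesis by simp
qed

lemma sum_ordered_pairs:
  assumes A: "finite A"
  shows "(\<Sum>x\<in>A. \<Sum>y\<in>A. if x \<noteq> y \<and> P {x, y} then 1 else (0::complex))
       = 2 * of_nat (card {B \<in> pairs A. P B})"
proof -
  let ?F = "{B \<in> pairs A. P B}"
  let ?S = "\<lambda>B. {(x, y). x \<noteq> y \<and> {x, y} = B}"
  let ?Q = "\<lambda>(x, y). x \<noteq> y \<and> P {x, y}"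
  have two: "card (?S B) = 2" if B2: "card B = 2" for B :: "'a set"
  proof -
    obtain a b where B: "B = {a, b}" "a \<noteq> b" using B2 by (auto simp: card_2_iff)
    then have "?S B = {(a, b), (b, a)}" by (auto simp: doubleton_eq_iff)
    then show ?thesis using B by simp
  qed
  have "(\<Sum>x\<in>A. \<Sum>y\<in>A. if x \<noteq> y \<and> P {x, y} then 1 else (0::complex))
      = (\<Sum>t\<in>A \<times> A. if ?Q t then 1 else 0)"
    unfolding sum.cartesian_product by (rule sum.cong[OF refl]) (simp add: case_prod_unfold)
  also have "\<dots> = of_nat (card {t \<in> A \<times> A. ?Q t})"
    by (subst sum.inter_filter[symmetric]) (use A in simp_all)
  also have "{t \<in> A \<times> A. ?Q t} = (\<Union>B\<in>?F. ?S B)"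
    unfolding pairs_def by auto
  also have "card (\<Union>B\<in>?F. ?S B) = (\<Sum>B\<in>?F. card (?S B))"
  proof (rule card_UN_disjoint)
    show "finite ?F" using finite_pairs[OF A] by simp
    show "\<forall>B\<in>?F. finite (?S B)"
      using two by (auto simp: pairs_def intro!: card_ge_0_finite)
  qed auto
  also have "\<dots> = (\<Sum>B\<in>?F. 2)"
    by (rule sum.cong[OF refl]) (use two in \<open>auto simp: pairs_def\<close>)
  finally show ?thesis by simp
qed

text \<open>
  A permutation of three points is counted by the permanent on the left and by the determinant on
  the right, which differ at the three transpositions.
\<close>
lemma fixed_triple_indicator:
  assumes s: "inj s"
  shows "(if distinct [x, y, z] \<and> s ` {x, y, z} = {x, y, z} then 1 else 0)
    = delta_det3 (s x) (s y) (s z) x y z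
      + 2 * (if y \<noteq> z \<and> s y = z \<and> s z = y then delta (s x) x else 0)
      + 2 * (if x \<noteq> z \<and> s x = z \<and> s z = x then delta (s y) y else 0)
      + 2 * (if x \<noteq> y \<and> s x = y \<and> s y = x then delta (s z) z else 0)"
proof -
  have e: "s x = s y \<longleftrightarrow> x = y" "s y = s z \<longleftrightarrow> y = z" "s x = s z \<longleftrightarrow> x = z"
    using s by (auto simp: inj_eq)
  show ?thesis
  proof (cases "distinct [x, y, z]")
    case False
    then consider "x = y" | "y = z" | "x = z" by auto
    then show ?thesis by cases (simp_all add: delta_det3_def delta_def)
  next
    case True
    then have d: "x \<noteq> y" "y \<noteq> z" "x \<noteq> z" by auto
    have "s ` {x, y, z} = {x, y, z} \<longleftrightarrow>
        s x = x \<and> s y = y \<and> s z = z \<or> s x = x \<and> s y = z \<and> s z = y \<or> s x = y \<and> s y = x \<and> s z = z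
      \<or> s x = y \<and> s y = z \<and> s z = x \<or> s x = z \<and> s y = x \<and> s z = y \<or> s x = z \<and> s y = y \<and> s z = x"
      (is "?L \<longleftrightarrow> ?R")
    proof
      assume eq: "s ` {x, y, z} = {x, y, z}"
      have "s x \<in> {x, y, z}" "s y \<in> {x, y, z}" "s z \<in> {x, y, z}"
        using equalityD1[OF eq] unfolding image_subset_iff by blast+
      then show ?R using d e by (elim insertE emptyE) simp_all
    next
      assume ?R
      then show "s ` {x, y, z} = {x, y, z}"
        by (elim disjE conjE) (simp_all add: insert_commute)
    qed
    moreover have "delta a b * delta c d * delta e f = (if a = b \<and> c = d \<and> e = f then 1 else 0)"
      for a b c d e f :: 'a by (simp add: delta_def)
    ultimately show ?thesis
      unfolding delta_det3_def using d
      by (cases ?R; (elim disjE conjE)?) (simp_all add: delta_def, blast?)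
  qed
qed

lemma fixed_pair_indicator:
  "(if x \<noteq> y \<and> s ` {x, y} = {x, y} then 1 else 0)
    = delta_det2 (s x) (s y) x y + 2 * (if x \<noteq> y \<and> s x = y \<and> s y = x then 1 else 0)"
  by (cases "x = y") (auto simp: delta_det2_def delta_def doubleton_eq_iff)

lemma delta_minors_rotate: "delta_minors b c v w u = delta_minors b c u v w"
  by (simp add: delta_minors_def add_ac)

text \<open>
  This is \<open>2 * n\<close> times the value at \<open>s\<close> of the character \<open>\<Lambda>\<^sup>2 - \<Lambda>\<^sup>1 + 1\<close> of the exterior square
  of the reflection representation, where \<open>\<Lambda>\<^sup>2\<close> and \<open>\<Lambda>\<^sup>1\<close> refer to the permutation representation.
\<close>
lemma sum_delta_minors_perm:
  assumes A: "finite A" "card A = n" and s: "s permutes A"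
  shows "(\<Sum>x\<in>A. \<Sum>y\<in>A. \<Sum>z\<in>A. delta_minors (s y) (s z) x y z)
    = of_nat n * ((\<Sum>y\<in>A. \<Sum>z\<in>A. delta_det2 (s y) (s z) y z) + 2 - 2 * (\<Sum>x\<in>A. delta (s x) x))"
proof -
  have sA: "s x \<in> A" if "x \<in> A" for x using that permutes_in_image[OF s] by simp
  have "(\<Sum>x\<in>A. \<Sum>y\<in>A. \<Sum>z\<in>A. delta_minors (s y) (s z) x y z)
      = (\<Sum>y\<in>A. \<Sum>x\<in>A. \<Sum>z\<in>A. delta_minors (s y) (s z) x y z)"
    by (rule sum.swap)
  also have "\<dots> = (\<Sum>y\<in>A. \<Sum>z\<in>A. \<Sum>x\<in>A. delta_minors (s y) (s z) x y z)"
    by (rule sum.cong[OF refl], rule sum.swap)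
  also have "\<dots> = (\<Sum>y\<in>A. \<Sum>z\<in>A. of_nat n * delta_det2 (s y) (s z) y z
      + delta (s y) z - delta (s z) z + delta (s z) y - delta (s y) y)"
    by (intro sum.cong refl)
      (simp add: delta_minors_def delta_det2_def sum.distrib sum_subtractf sum_delta1 sA A
        flip: sum_distrib_left sum_distrib_right)
  also have "\<dots> = of_nat n * (\<Sum>y\<in>A. \<Sum>z\<in>A. delta_det2 (s y) (s z) y z)
      + (\<Sum>y\<in>A. \<Sum>z\<in>A. delta (s y) z) - (\<Sum>y\<in>A. \<Sum>z\<in>A. delta (s z) z)
      + (\<Sum>y\<in>A. \<Sum>z\<in>A. delta (s z) y) - (\<Sum>y\<in>A. \<Sum>z\<in>A. delta (s y) y)"
    by (simp only: sum.distrib sum_subtractf sum_distrib_left)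
  also have "(\<Sum>y\<in>A. \<Sum>z\<in>A. delta (s z) y) = (\<Sum>z\<in>A. \<Sum>y\<in>A. delta (s z) y)"
    by (rule sum.swap)
  finally show ?thesis
    using A by (simp add: sum_delta1 sA algebra_simps flip: sum_distrib_left)
qed

text \<open>
  With \<open>?p\<close> fixed points and \<open>?w\<close> points in 2-cycles, the fixed 3-subsets exceed the trace on the
  exterior cube by \<open>?p * ?w\<close> and the fixed 2-subsets exceed the one on the exterior square by \<open>?w\<close>.
  What remains is \<open>?p - 1\<close>.
\<close>
theorem character_difference:
  fixes A :: "'a set"
  assumes A: "finite A" "card A = n" and n: "n \<ge> 7" and s: "s permutes A"
  shows "sym_char (hook4 n) A s - sym_char (shape222 n) A s
    = of_int (sign s * ((fixed_count A s - 1) * (1 - swapped_count A s)))"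
proof -
  let ?p = "\<Sum>x\<in>A. delta (s x) x"
  let ?w = "\<Sum>x\<in>A. \<Sum>y\<in>A. if x \<noteq> y \<and> s x = y \<and> s y = x then 1 else (0::complex)"
  let ?d2 = "\<Sum>x\<in>A. \<Sum>y\<in>A. delta_det2 (s x) (s y) x y"
  let ?d3 = "\<Sum>x\<in>A. \<Sum>y\<in>A. \<Sum>z\<in>A. delta_det3 (s x) (s y) (s z) x y z"
  have inj: "inj s" using permutes_inj[OF s] .
  have p: "of_int (fixed_count A s) = ?p"
    unfolding fixed_count_def delta_def by (simp add: if_distrib[of of_int] cong: if_cong)
  have w: "of_int (swapped_count A s) = ?w"
    unfolding swapped_count_def by (simp add: if_distrib[of of_int] cong: if_cong)
  have t: "(\<Sum>x\<in>A. \<Sum>y\<in>A. \<Sum>z\<in>A. if y \<noteq> z \<and> s y = z \<and> s z = y then delta (s x) x else 0) = ?p * ?w"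
  proof -
    have "(\<Sum>x\<in>A. \<Sum>y\<in>A. \<Sum>z\<in>A. if y \<noteq> z \<and> s y = z \<and> s z = y then delta (s x) x else 0)
        = (\<Sum>x\<in>A. delta (s x) x * ?w)"
    proof (rule sum.cong[OF refl])
      fix x
      show "(\<Sum>y\<in>A. \<Sum>z\<in>A. if y \<noteq> z \<and> s y = z \<and> s z = y then delta (s x) x else 0) = delta (s x) x * ?w"
        unfolding sum_distrib_left by (intro sum.cong refl) simp
    qed
    then show ?thesis by (simp only: sum_distrib_right)
  qed
  have t': "(\<Sum>x\<in>A. \<Sum>y\<in>A. \<Sum>z\<in>A. if x \<noteq> z \<and> s x = z \<and> s z = x then delta (s y) y else 0) = ?p * ?w"
    using t by (rule trans[OF sum.swap])
  have t'': "(\<Sum>x\<in>A. \<Sum>y\<in>A. \<Sum>z\<in>A. if x \<noteq> y \<and> s x = y \<and> s y = x then delta (s z) z else 0) = ?p * ?w"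
  proof -
    have "(\<Sum>x\<in>A. \<Sum>y\<in>A. \<Sum>z\<in>A. if x \<noteq> y \<and> s x = y \<and> s y = x then delta (s z) z else 0)
        = (\<Sum>x\<in>A. \<Sum>z\<in>A. \<Sum>y\<in>A. if x \<noteq> y \<and> s x = y \<and> s y = x then delta (s z) z else 0)"
      by (rule sum.cong[OF refl], rule sum.swap)
    then show ?thesis using t' by simp
  qed
  have three: "6 * of_nat (card {B \<in> triples A. s ` B = B}) = ?d3 + 6 * (?p * ?w)"
    unfolding sum_ordered_triples[OF A(1), of "\<lambda>B. s ` B = B", symmetric]
    unfolding fixed_triple_indicator[OF inj] sum.distrib sum_distrib_left[symmetric] t t' t''
    by simp
  have two: "2 * of_nat (card {P \<in> pairs A. s ` P = P}) = ?d2 + 2 * ?w"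
    unfolding sum_ordered_pairs[OF A(1), of "\<lambda>B. s ` B = B", symmetric]
    unfolding fixed_pair_indicator sum.distrib sum_distrib_left[symmetric] by simp
  \<comment> \<open>The three sums in \<open>wedge_proj\<close> agree after renaming the summation variables.\<close>
  let ?M = "of_nat n * (?d2 + 2 - 2 * ?p)"
  have M1: "(\<Sum>x\<in>A. \<Sum>y\<in>A. \<Sum>z\<in>A. delta_minors (s y) (s z) x y z) = ?M"
    by (rule sum_delta_minors_perm[OF A s])
  have M2: "(\<Sum>x\<in>A. \<Sum>y\<in>A. \<Sum>z\<in>A. delta_minors (s z) (s x) x y z) = ?M"
  proof -
    have "(\<Sum>x\<in>A. \<Sum>y\<in>A. \<Sum>z\<in>A. delta_minors (s z) (s x) x y z)
        = (\<Sum>x\<in>A. \<Sum>y\<in>A. \<Sum>z\<in>A. delta_minors (s z) (s x) y z x)"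
      by (intro sum.cong refl) (rule delta_minors_rotate[symmetric])
    also have "\<dots> = (\<Sum>y\<in>A. \<Sum>x\<in>A. \<Sum>z\<in>A. delta_minors (s z) (s x) y z x)"
      by (rule sum.swap)
    also have "\<dots> = (\<Sum>y\<in>A. \<Sum>z\<in>A. \<Sum>x\<in>A. delta_minors (s z) (s x) y z x)"
      by (rule sum.cong[OF refl], rule sum.swap)
    finally show ?thesis using M1 by simp
  qed
  have M3: "(\<Sum>x\<in>A. \<Sum>y\<in>A. \<Sum>z\<in>A. delta_minors (s x) (s y) x y z) = ?M"
  proof -
    have "(\<Sum>x\<in>A. \<Sum>y\<in>A. \<Sum>z\<in>A. delta_minors (s x) (s y) x y z)
        = (\<Sum>x\<in>A. \<Sum>y\<in>A. \<Sum>z\<in>A. delta_minors (s x) (s y) z x y)"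
      by (intro sum.cong refl) (rule delta_minors_rotate)
    also have "\<dots> = (\<Sum>x\<in>A. \<Sum>z\<in>A. \<Sum>y\<in>A. delta_minors (s x) (s y) z x y)"
      by (rule sum.cong[OF refl], rule sum.swap)
    also have "\<dots> = (\<Sum>z\<in>A. \<Sum>x\<in>A. \<Sum>y\<in>A. delta_minors (s x) (s y) z x y)"
      by (rule sum.swap)
    finally show ?thesis using M1 by simp
  qed
  have "(\<Sum>x\<in>A. \<Sum>y\<in>A. \<Sum>z\<in>A. wedge_proj n (s x) (s y) (s z) x y z)
      = (?d3 - (?M + ?M + ?M) / of_nat n) / 6"
    unfolding wedge_proj_def sum_divide_distrib[symmetric] sum_subtractf sum.distrib M1 M2 M3 ..
  also have "\<dots> = ?d3 / 6 - ?d2 / 2 - 1 + ?p"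
    using n by (simp add: field_simps)
  finally have hook: "sym_char (hook4 n) A s = of_int (sign s) * (?d3 / 6 - ?d2 / 2 - 1 + ?p)"
    using sym_char_hook4[OF A _ s] n by simp
  have two_three: "sym_char (shape222 n) A s
      = of_int (sign s) * ((?d3 + 6 * (?p * ?w)) / 6 - (?d2 + 2 * ?w) / 2)"
    unfolding sym_char_222[OF A n s] three[symmetric] two[symmetric] by simp
  show ?thesis
    unfolding hook two_three of_int_mult of_int_diff of_int_1 p w by (simp add: field_simps)
qed

section \<open>Determinants and permutations with prescribed values\<close>

text \<open>
  Determinants of matrices indexed by an arbitrary finite set, so that the sums over the
  permutations of a group carrier can be treated as they stand.
\<close>
definition set_det :: "'a set \<Rightarrow> ('a \<Rightarrow> 'a \<Rightarrow> 'r) \<Rightarrow> 'r :: comm_ring_1" where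
  "set_det A M = (\<Sum>s | s permutes A. of_int (sign s) * (\<Prod>a\<in>A. M a (s a)))"

lemma set_det_cong:
  assumes "\<And>a b. a \<in> A \<Longrightarrow> b \<in> A \<Longrightarrow> M a b = N a b"
  shows "set_det A M = set_det A N"
  unfolding set_det_def
  by (intro sum.cong arg_cong2[where f = "(*)"] prod.cong refl) (use assms in \<open>auto simp: permutes_in_image\<close>)

lemma set_det_scale_rows:
  "set_det A (\<lambda>a b. c a * M a b) = (\<Prod>a\<in>A. c a) * set_det A M"
  unfolding set_det_def sum_distrib_left by (simp add: prod.distrib mult.left_commute)

lemma set_det_eq_det:
  fixes M :: "'a \<Rightarrow> 'a \<Rightarrow> 'r :: comm_ring_1"
  assumes e: "bij_betw e {0..<n} A"
  shows "set_det A M = det (mat n n (\<lambda>(i, j). M (e i) (e j)))"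
proof -
  let ?N = "{0..<n}"
  let ?m = "map_permutation ?N e"
  have inj: "inj_on e ?N" and img: "e ` ?N = A" using e by (auto simp: bij_betw_def)
  have inv: "bij_betw (inv_into ?N e) A ?N" using e by (rule bij_betw_inv_into)
  have "det (mat n n (\<lambda>(i, j). M (e i) (e j)))
      = (\<Sum>p | p permutes ?N. of_int (sign p) * (\<Prod>i = 0..<n. M (e i) (e (p i))))"
    unfolding det_def'[OF mat_carrier]
    by (intro sum.cong arg_cong2[where f = "(*)"] prod.cong refl) (auto dest: permutes_in_image)
  also have "\<dots> = (\<Sum>s | s permutes A. of_int (sign s) * (\<Prod>a\<in>A. M a (s a)))"
  proof (rule sum.reindex_bij_witness[where j = ?m and i = "map_permutation A (inv_into ?N e)"])
    fix p assume "p \<in> {p. p permutes ?N}"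
    then have p: "p permutes ?N" by simp
    show "map_permutation A (inv_into ?N e) (?m p) = p"
      by (rule map_permutation_compose_inv[OF e p]) (use inj in auto)
    show "?m p \<in> {s. s permutes A}"
      using map_permutation_permutes[OF e p] by simp
    have "(\<Prod>a\<in>A. M a (?m p a)) = (\<Prod>i = 0..<n. M (e i) (?m p (e i)))"
      using prod.reindex_bij_betw[OF e, of "\<lambda>a. M a (?m p a)"] by simp
    also have "\<dots> = (\<Prod>i = 0..<n. M (e i) (e (p i)))"
      by (rule prod.cong) (simp_all add: map_permutation_apply[OF inj])
    finally show "of_int (sign (?m p)) * (\<Prod>a\<in>A. M a (?m p a))
        = of_int (sign p) * (\<Prod>i = 0..<n. M (e i) (e (p i)))"
      using sign_map_permutation[OF inj p] by simp
  next
    fix s assume "s \<in> {s. s permutes A}"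
    then have s: "s permutes A" by simp
    show "?m (map_permutation A (inv_into ?N e) s) = s"
      by (rule map_permutation_compose_inv[OF inv s]) (use img in \<open>auto simp: f_inv_into_f\<close>)
    show "map_permutation A (inv_into ?N e) s \<in> {p. p permutes ?N}"
      using map_permutation_permutes[OF inv s] by simp
  qed
  finally show ?thesis unfolding set_det_def ..
qed

lemma set_det_mult:
  fixes M N :: "'a \<Rightarrow> 'a \<Rightarrow> 'r :: comm_ring_1"
  assumes A: "finite A"
  shows "set_det A (\<lambda>a c. \<Sum>b\<in>A. N a b * M b c) = set_det A N * set_det A M"
proof -
  obtain e where e: "bij_betw e {0..<card A} A"
    using ex_bij_betw_nat_finite[OF A] by blast
  let ?n = "card A"
  let ?mat = "\<lambda>M. mat ?n ?n (\<lambda>(i, j). M (e i) (e j)) :: 'r mat"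
  have "?mat (\<lambda>a c. \<Sum>b\<in>A. N a b * M b c) = ?mat N * ?mat M"
    by (rule eq_matI) (simp_all add: scalar_prod_def flip: sum.reindex_bij_betw[OF e])
  then show ?thesis
    unfolding set_det_eq_det[OF e] using det_mult[of "?mat N" ?n "?mat M"] by simp
qed

lemma set_adjugate_ex:
  fixes M :: "'a \<Rightarrow> 'a \<Rightarrow> 'r :: comm_ring_1"
  assumes A: "finite A"
  obtains Y where
    "\<And>a c. a \<in> A \<Longrightarrow> c \<in> A \<Longrightarrow> (\<Sum>b\<in>A. M a b * Y b c) = (if a = c then set_det A M else 0)"
    "\<And>a c. a \<in> A \<Longrightarrow> c \<in> A \<Longrightarrow> (\<Sum>b\<in>A. Y a b * M b c) = (if a = c then set_det A M else 0)"
proof -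
  obtain e where e: "bij_betw e {0..<card A} A"
    using ex_bij_betw_nat_finite[OF A] by blast
  let ?n = "card A"
  let ?M = "mat ?n ?n (\<lambda>(i, j). M (e i) (e j)) :: 'r mat"
  let ?i = "inv_into {0..<?n} e"
  define Y where "Y = (\<lambda>a b. adj_mat ?M $$ (?i a, ?i b))"
  have M: "?M \<in> carrier_mat ?n ?n" by simp
  have adj: "adj_mat ?M \<in> carrier_mat ?n ?n" by (rule adj_mat(1)[OF M])
  have i: "?i a < ?n" "e (?i a) = a" if "a \<in> A" for a
    using that e bij_betw_inv_into_right[OF e] bij_betwE[OF bij_betw_inv_into[OF e]] by auto
  have i_e: "?i (e k) = k" if "k < ?n" for k
    using bij_betw_inv_into_left[OF e] that by simp
  have i_eq: "?i a = ?i c \<longleftrightarrow> a = c" if "a \<in> A" "c \<in> A" for a c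
    using i(2) that by metis
  have det: "det ?M = set_det A M" using set_det_eq_det[OF e, of M] by simp
  have 1: "(\<Sum>b\<in>A. M a b * Y b c) = (if a = c then set_det A M else 0)" if ac: "a \<in> A" "c \<in> A" for a c
  proof -
    have "(?M * adj_mat ?M) $$ (?i a, ?i c) = (\<Sum>k = 0..<?n. M a (e k) * Y (e k) c)"
      using adj i ac by (simp add: scalar_prod_def Y_def i_e)
    also have "\<dots> = (\<Sum>b\<in>A. M a b * Y b c)"
      by (rule sum.reindex_bij_betw[OF e])
    finally show ?thesis
      using i ac i_eq[OF ac] by (simp add: adj_mat(2)[OF M] det split: if_splits)
  qed
  have 2: "(\<Sum>b\<in>A. Y a b * M b c) = (if a = c then set_det A M else 0)" if ac: "a \<in> A" "c \<in> A" for a c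
  proof -
    have "(adj_mat ?M * ?M) $$ (?i a, ?i c) = (\<Sum>k = 0..<?n. Y a (e k) * M (e k) c)"
      using adj i ac by (simp add: scalar_prod_def Y_def i_e)
    also have "\<dots> = (\<Sum>b\<in>A. Y a b * M b c)"
      by (rule sum.reindex_bij_betw[OF e])
    finally show ?thesis
      using i ac i_eq[OF ac] by (simp add: adj_mat(3)[OF M] det split: if_splits)
  qed
  show thesis by (rule that[of Y]) (fact 1, fact 2)
qed

text \<open>Only permutations that fix every point outside \<open>W\<close> contribute.\<close>
lemma set_det_identity_rows:
  assumes A: "finite A" and W: "W \<subseteq> A"
  shows "set_det A (\<lambda>a b. if a \<in> W then N a b else if a = b then 1 else 0) = set_det W N"
proof -
  let ?N = "\<lambda>a b. if a \<in> W then N a b else if a = b then 1 else 0"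
  have "set_det A ?N = (\<Sum>s | s permutes W. of_int (sign s) * (\<Prod>a\<in>A. ?N a (s a)))"
    unfolding set_det_def
  proof (rule sum.mono_neutral_right)
    show "finite {s. s permutes A}" using A by (rule finite_permutations)
    show "{s. s permutes W} \<subseteq> {s. s permutes A}" using permutes_subset[OF _ W] by auto
    show "\<forall>s\<in>{s. s permutes A} - {s. s permutes W}. of_int (sign s) * (\<Prod>a\<in>A. ?N a (s a)) = 0"
    proof
      fix s assume s: "s \<in> {s. s permutes A} - {s. s permutes W}"
      then obtain a where "a \<in> A - W" "s a \<noteq> a" using permutes_superset[of s A W] by auto
      then have "(\<Prod>a\<in>A. ?N a (s a)) = 0" using A by (intro prod_zero) (auto intro!: bexI[of _ a])
      then show "of_int (sign s) * (\<Prod>a\<in>A. ?N a (s a)) = 0" by simp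
    qed
  qed
  also have "\<dots> = (\<Sum>s | s permutes W. of_int (sign s) * (\<Prod>a\<in>W. N a (s a)))"
  proof (intro sum.cong refl arg_cong2[where f = "(*)"])
    fix s assume s: "s \<in> {s. s permutes W}"
    have "(\<Prod>a\<in>A. ?N a (s a)) = (\<Prod>a\<in>W. ?N a (s a))"
      using A W s by (intro prod.mono_neutral_right) (auto simp: permutes_def)
    then show "(\<Prod>a\<in>A. ?N a (s a)) = (\<Prod>a\<in>W. N a (s a))" by simp
  qed
  finally show ?thesis unfolding set_det_def .
qed

lemma set_det_unit_rows:
  assumes A: "finite A" and W: "W \<subseteq> A"
  shows "set_det A (\<lambda>a b. if a \<in> W then if b = f a then M a b else 0 else M a b)
    = (\<Sum>s | s permutes A \<and> (\<forall>a\<in>W. s a = f a). of_int (sign s) * (\<Prod>a\<in>A. M a (s a)))"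
proof -
  let ?N = "\<lambda>a b. if a \<in> W then if b = f a then M a b else 0 else M a b"
  show ?thesis unfolding set_det_def
  proof (rule sum.mono_neutral_cong_right)
    show "finite {s. s permutes A}" using A by (rule finite_permutations)
    show "\<forall>s\<in>{s. s permutes A} - {s. s permutes A \<and> (\<forall>a\<in>W. s a = f a)}.
        of_int (sign s) * (\<Prod>a\<in>A. ?N a (s a)) = 0"
    proof
      fix s assume "s \<in> {s. s permutes A} - {s. s permutes A \<and> (\<forall>a\<in>W. s a = f a)}"
      then obtain a where "a \<in> W" "s a \<noteq> f a" by auto
      then have "(\<Prod>a\<in>A. ?N a (s a)) = 0" using A W by (intro prod_zero) (auto intro!: bexI[of _ a])
      then show "of_int (sign s) * (\<Prod>a\<in>A. ?N a (s a)) = 0" by simp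
    qed
  qed (auto intro!: arg_cong2[where f = "(*)"] prod.cong)
qed

text \<open>
  Jacobi's theorem on complementary minors for the adjugate \<open>Y\<close>. Replace row \<open>a \<in> W\<close> of \<open>M\<close> by
  the unit row at \<open>f a\<close> times \<open>M a (f a)\<close>. Up to factors \<open>det M\<close> in these rows this is \<open>N * M\<close>, where
  \<open>N\<close> is the identity except that row \<open>a \<in> W\<close> is \<open>M a (f a)\<close> times row \<open>f a\<close> of \<open>Y\<close>.
\<close>
lemma jacobi_prescribed_values:
  fixes M :: "'a \<Rightarrow> 'a \<Rightarrow> 'r :: comm_ring_1"
  assumes A: "finite A" and W: "W \<subseteq> A" and f: "\<And>a. a \<in> W \<Longrightarrow> f a \<in> A"
    and Y: "\<And>a c. a \<in> A \<Longrightarrow> c \<in> A \<Longrightarrow> (\<Sum>b\<in>A. Y a b * M b c) = (if a = c then set_det A M else 0)"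
  shows "set_det A M ^ card W *
      (\<Sum>s | s permutes A \<and> (\<forall>a\<in>W. s a = f a). of_int (sign s) * (\<Prod>a\<in>A. M a (s a)))
    = set_det A M * ((\<Prod>a\<in>W. M a (f a)) * set_det W (\<lambda>a b. Y (f a) b))"
proof -
  let ?D = "set_det A M"
  let ?U = "\<lambda>a b. if a \<in> W then if b = f a then M a b else 0 else M a b"
  let ?N = "\<lambda>a b. if a \<in> W then M a (f a) * Y (f a) b else if a = b then 1 else 0"
  have finW: "finite W" using A W finite_subset by blast
  have "?D ^ card W * set_det A ?U = set_det A (\<lambda>a b. (if a \<in> W then ?D else 1) * ?U a b)"
    unfolding set_det_scale_rows
    using A W by (simp add: prod.If_cases Int_absorb1)
  also have "\<dots> = set_det A (\<lambda>a c. \<Sum>b\<in>A. ?N a b * M b c)"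
  proof (rule set_det_cong)
    fix a c assume a: "a \<in> A" and c: "c \<in> A"
    show "(if a \<in> W then ?D else 1) * ?U a c = (\<Sum>b\<in>A. ?N a b * M b c)"
    proof (cases "a \<in> W")
      case True
      then have "(\<Sum>b\<in>A. ?N a b * M b c) = M a (f a) * (\<Sum>b\<in>A. Y (f a) b * M b c)"
        by (simp add: sum_distrib_left mult.assoc)
      then show ?thesis using True Y[OF f c] by (auto simp: mult.commute)
    next
      case False
      then have "(\<Sum>b\<in>A. ?N a b * M b c) = (\<Sum>b\<in>A. if a = b then M b c else 0)"
        by (intro sum.cong) auto
      then show ?thesis using False a A by simp
    qed
  qed
  also have "\<dots> = set_det A ?N * ?D" by (rule set_det_mult[OF A])
  also have "set_det A ?N = set_det W (\<lambda>a b. M a (f a) * Y (f a) b)"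
    by (rule set_det_identity_rows[OF A W])
  also have "\<dots> = (\<Prod>a\<in>W. M a (f a)) * set_det W (\<lambda>a b. Y (f a) b)"
    by (rule set_det_scale_rows)
  finally show ?thesis
    unfolding set_det_unit_rows[OF A W] by (simp add: mult.commute)
qed

lemma set_det_1: "set_det {a} M = M a a"
  unfolding set_det_def by (simp add: permutes_sing)

lemma set_det_2:
  assumes "a \<noteq> b"
  shows "set_det {a, b} M = M a a * M b b - M a b * M b a"
proof -
  have 1: "finite {b}" "a \<notin> {b}" using assms by auto
  show ?thesis
    unfolding set_det_def sum_over_permutations_insert[OF 1] permutes_sing
    using assms by (simp add: sign_swap_id)
qed

lemma set_det_3:
  assumes "a \<noteq> b" "b \<noteq> c" "a \<noteq> c"
  shows "set_det {a, b, c} M = M a a * M b b * M c c + M a b * M b c * M c a + M a c * M b a * M c b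
     - M a b * M b a * M c c - M a c * M b b * M c a - M a a * M b c * M c b"
proof -
  have 1: "finite {b, c}" "a \<notin> {b, c}" and 2: "finite {c}" "b \<notin> {c}" using assms by auto
  show ?thesis
    unfolding set_det_def sum_over_permutations_insert[OF 1] sum_over_permutations_insert[OF 2] permutes_sing
    using assms
    by (simp add: sign_swap_id permutation_swap_id sign_compose transpose_def algebra_simps)
qed

section \<open>Group matrices of abelian groups of odd order\<close>

context comm_group
begin

text \<open>The inverse map is \<open>a \<mapsto> a [^] ((n + 1) / 2)\<close> with \<open>n = order G\<close>.\<close>
lemma odd_order_square_bij:
  assumes fin: "finite (carrier G)" and odd: "odd (order G)"
  shows "bij_betw (\<lambda>a. a \<otimes> a) (carrier G) (carrier G)"
proof -
  have root: "(a \<otimes> a) [^] ((order G + 1) div 2) = a" if a: "a \<in> carrier G" for a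
  proof -
    have "a \<otimes> a = a [^] Suc (Suc 0)" using a by simp
    then have "(a \<otimes> a) [^] ((order G + 1) div 2) = a [^] (Suc (Suc 0) * ((order G + 1) div 2))"
      using a by (simp only: nat_pow_pow)
    also have "\<dots> = a [^] (order G + 1)"
      using odd by (intro arg_cong[where f = "\<lambda>k. a [^] (k::nat)"]) presburger
    also have "\<dots> = a"
      using a pow_order_eq_1[OF a] by simp
    finally show ?thesis .
  qed
  have inj: "inj_on (\<lambda>a. a \<otimes> a) (carrier G)"
    by (rule inj_on_inverseI, rule root)
  moreover have "(\<lambda>a. a \<otimes> a) ` carrier G = carrier G"
    by (rule endo_inj_surj[OF fin _ inj]) auto
  ultimately show ?thesis unfolding bij_betw_def by (rule conjI)
qed

end

locale odd_group_matrix = comm_group G for G :: "('a, 'm) monoid_scheme" (structure) +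
  fixes x :: "'a \<Rightarrow> 'r :: comm_ring_1"
  assumes fin: "finite (carrier G)" and odd_order: "odd (order G)"
    and regular: "\<And>r. set_det (carrier G) (\<lambda>a b. x (a \<otimes> b)) * r = 0 \<Longrightarrow> r = 0"
begin

abbreviation A :: "'a set" where "A \<equiv> carrier G"

definition M :: "'a \<Rightarrow> 'a \<Rightarrow> 'r" where "M a b = x (a \<otimes> b)"

definition D :: 'r where "D = set_det A M"

lemma cancel: "D * r = D * s \<Longrightarrow> r = s"
  using regular[of "r - s"] unfolding D_def M_def by (simp add: right_diff_distrib)

lemma sum_translate: "c \<in> A \<Longrightarrow> (\<Sum>a\<in>A. f (c \<otimes> a)) = (\<Sum>a\<in>A. f a)"
  by (rule sum.reindex_bij_witness[where i = "\<lambda>a. inv c \<otimes> a" and j = "\<lambda>a. c \<otimes> a"])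
    (simp_all flip: m_assoc)

lemma sum_inverse: "(\<Sum>a\<in>A. f (inv a)) = (\<Sum>a\<in>A. f a)"
  by (rule sum.reindex_bij_witness[where i = "\<lambda>a. inv a" and j = "\<lambda>a. inv a"]) simp_all

lemma sum_square: "(\<Sum>a\<in>A. f (a \<otimes> a)) = (\<Sum>a\<in>A. f a)"
  by (rule sum.reindex_bij_betw[OF odd_order_square_bij[OF fin odd_order]])

lemma square_eq_iff: "a \<in> A \<Longrightarrow> b \<in> A \<Longrightarrow> a \<otimes> a = b \<otimes> b \<longleftrightarrow> a = b"
  using odd_order_square_bij[OF fin odd_order] by (auto simp: bij_betw_def dest: inj_onD)

text \<open>
  The adjugate \<open>Y\<close> is again a matrix of the form \<open>y (a \<otimes> b)\<close>: with \<open>y\<close> read off from one of its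
  columns, every column \<open>Y _ b\<close> and its candidate \<open>y (_ \<otimes> b)\<close> have the same product with \<open>M\<close>, and
  \<open>M\<close> is injective as \<open>D\<close> is regular.
\<close>
lemma inverse_entries_ex:
  obtains y where
    "\<And>u v. u \<in> A \<Longrightarrow> v \<in> A \<Longrightarrow> (\<Sum>s\<in>A. x (s \<otimes> u) * y (s \<otimes> v)) = (if u = v then D else 0)"
    "\<And>a c. a \<in> A \<Longrightarrow> c \<in> A \<Longrightarrow> (\<Sum>b\<in>A. y (a \<otimes> b) * M b c) = (if a = c then set_det A M else 0)"
proof -
  obtain Y where MY: "\<And>a c. a \<in> A \<Longrightarrow> c \<in> A \<Longrightarrow> (\<Sum>b\<in>A. M a b * Y b c) = (if a = c then set_det A M else 0)"
    and YM: "\<And>a c. a \<in> A \<Longrightarrow> c \<in> A \<Longrightarrow> (\<Sum>b\<in>A. Y a b * M b c) = (if a = c then set_det A M else 0)"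
    using set_adjugate_ex[OF fin, of M] by blast
  define y where "y = (\<lambda>s. Y s \<one>)"
  have My: "(\<Sum>s\<in>A. x (s \<otimes> u) * y (s \<otimes> v)) = (if u = v then D else 0)"
    if uv: "u \<in> A" "v \<in> A" for u v
  proof -
    have "(\<Sum>s\<in>A. x (s \<otimes> u) * y (s \<otimes> v)) = (\<Sum>s\<in>A. M (u \<otimes> inv v) (v \<otimes> s) * Y (v \<otimes> s) \<one>)"
    proof (rule sum.cong[OF refl])
      fix s assume s: "s \<in> A"
      have "inv v \<otimes> (v \<otimes> s) = s"
        using s uv by (simp flip: m_assoc)
      then have "u \<otimes> inv v \<otimes> (v \<otimes> s) = s \<otimes> u"
        using s uv by (simp add: m_assoc m_comm[of u s])
      then show "x (s \<otimes> u) * y (s \<otimes> v) = M (u \<otimes> inv v) (v \<otimes> s) * Y (v \<otimes> s) \<one>"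
        using s uv by (simp add: M_def y_def m_comm)
    qed
    also have "\<dots> = (\<Sum>s\<in>A. M (u \<otimes> inv v) s * Y s \<one>)"
      by (rule sum_translate[OF uv(2)])
    also have "\<dots> = (if u \<otimes> inv v = \<one> then D else 0)"
      using uv by (simp add: MY D_def)
    also have "u \<otimes> inv v = \<one> \<longleftrightarrow> u = v"
      using uv by (metis inv_closed inv_equality inv_inv r_inv)
    finally show ?thesis .
  qed
  have Yy: "Y a b = y (a \<otimes> b)" if ab: "a \<in> A" "b \<in> A" for a b
  proof -
    have kernel: "(\<Sum>e\<in>A. M c e * (Y e b - y (e \<otimes> b))) = 0" if c: "c \<in> A" for c
    proof -
      have "(\<Sum>e\<in>A. M c e * y (e \<otimes> b)) = (\<Sum>e\<in>A. x (e \<otimes> c) * y (e \<otimes> b))"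
        by (rule sum.cong) (use c in \<open>auto simp: M_def m_comm\<close>)
      then show ?thesis
        using MY[OF c ab(2)] My[OF c ab(2)] by (simp add: right_diff_distrib sum_subtractf D_def)
    qed
    have "D * (Y a b - y (a \<otimes> b)) = (\<Sum>e\<in>A. (if a = e then D else 0) * (Y e b - y (e \<otimes> b)))"
      using ab fin by (simp add: if_distrib[of "\<lambda>c. c * _"] cong: if_cong)
    also have "\<dots> = (\<Sum>e\<in>A. (\<Sum>c\<in>A. Y a c * M c e) * (Y e b - y (e \<otimes> b)))"
      by (rule sum.cong) (use YM[OF ab(1)] in \<open>auto simp: D_def\<close>)
    also have "\<dots> = (\<Sum>e\<in>A. \<Sum>c\<in>A. Y a c * (M c e * (Y e b - y (e \<otimes> b))))"
      by (simp add: sum_distrib_right mult.assoc)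
    also have "\<dots> = (\<Sum>c\<in>A. Y a c * (\<Sum>e\<in>A. M c e * (Y e b - y (e \<otimes> b))))"
      by (subst sum.swap) (simp add: sum_distrib_left)
    also have "\<dots> = D * 0" by (simp add: kernel)
    finally show ?thesis using cancel by fastforce
  qed
  show thesis
  proof (rule that[of y])
    show "(\<Sum>b\<in>A. y (a \<otimes> b) * M b c) = (if a = c then set_det A M else 0)" if "a \<in> A" "c \<in> A" for a c
      using YM[OF that] that by (simp add: Yy cong: sum.cong)
  qed (rule My)
qed

definition signed_term :: "('a \<Rightarrow> 'a) \<Rightarrow> 'r" where
  "signed_term s = of_int (sign s) * (\<Prod>a\<in>A. M a (s a))"

lemma D_eq: "D = (\<Sum>s | s permutes A. signed_term s)"
  unfolding D_def set_det_def signed_term_def ..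

context
  fixes y :: "'a \<Rightarrow> 'r"
  assumes orth: "\<And>u v. u \<in> A \<Longrightarrow> v \<in> A \<Longrightarrow>
      (\<Sum>s\<in>A. x (s \<otimes> u) * y (s \<otimes> v)) = (if u = v then D else 0)"
    and inverse: "\<And>a c. a \<in> A \<Longrightarrow> c \<in> A \<Longrightarrow>
      (\<Sum>b\<in>A. y (a \<otimes> b) * M b c) = (if a = c then set_det A M else 0)"
begin

lemma jacobi:
  assumes W: "W \<subseteq> A" and f: "\<And>a. a \<in> W \<Longrightarrow> f a \<in> A"
  shows "D ^ card W * (\<Sum>s | s permutes A \<and> (\<forall>a\<in>W. s a = f a). signed_term s)
    = D * ((\<Prod>a\<in>W. M a (f a)) * set_det W (\<lambda>a b. y (f a \<otimes> b)))"
  unfolding D_def signed_term_def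
  by (rule jacobi_prescribed_values[where Y = "\<lambda>a b. y (a \<otimes> b)", OF fin W f inverse])

lemma sum_diagonal: "(\<Sum>d\<in>A. x (d \<otimes> d) * y (d \<otimes> d)) = D"
  using orth[of \<one> \<one>] by (simp add: sum_square[of "\<lambda>d. x d * y d"])

text \<open>The permutations fixing \<open>a\<close> contribute \<open>x (a \<otimes> a) * y (a \<otimes> a)\<close>, which sums to \<open>D\<close>.\<close>
lemma fixed_sum: "(\<Sum>s | s permutes A. of_int (fixed_count A s) * signed_term s) = D"
proof -
  have finp: "finite {s. s permutes A}" using finite_permutations[OF fin] .
  have "(\<Sum>s | s permutes A. of_int (fixed_count A s) * signed_term s)
      = (\<Sum>s | s permutes A. \<Sum>a\<in>A. if s a = a then signed_term s else 0)"
    unfolding fixed_count_def of_int_sum sum_distrib_right by (intro sum.cong refl) simp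
  also have "\<dots> = (\<Sum>a\<in>A. \<Sum>s | s permutes A. if s a = a then signed_term s else 0)"
    by (rule sum.swap)
  also have "\<dots> = (\<Sum>a\<in>A. x (a \<otimes> a) * y (a \<otimes> a))"
  proof (rule sum.cong[OF refl])
    fix a assume a: "a \<in> A"
    have "D * (\<Sum>s | s permutes A \<and> s a = a. signed_term s) = D * (x (a \<otimes> a) * y (a \<otimes> a))"
      using jacobi[of "{a}" "\<lambda>a. a"] a by (simp add: set_det_1 M_def)
    then have "(\<Sum>s | s permutes A \<and> s a = a. signed_term s) = x (a \<otimes> a) * y (a \<otimes> a)"
      by (rule cancel)
    moreover have "(\<Sum>s | s permutes A. if s a = a then signed_term s else 0)
        = (\<Sum>s | s permutes A \<and> s a = a. signed_term s)"
      using sum.inter_filter[OF finp, of signed_term "\<lambda>s. s a = a"] by simp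
    ultimately show "(\<Sum>s | s permutes A. if s a = a then signed_term s else 0) = x (a \<otimes> a) * y (a \<otimes> a)" by simp
  qed
  finally show ?thesis by (simp add: sum_diagonal)
qed

lemma y_comm: "a \<in> A \<Longrightarrow> b \<in> A \<Longrightarrow> y (b \<otimes> a) = y (a \<otimes> b)"
  by (simp add: m_comm)

lemma x_comm: "a \<in> A \<Longrightarrow> b \<in> A \<Longrightarrow> x (b \<otimes> a) = x (a \<otimes> b)"
  by (simp add: m_comm)

lemma swap_sum_at:
  assumes ab: "a \<in> A" "b \<in> A"
  shows "D * (\<Sum>s | s permutes A. if a \<noteq> b \<and> s a = b \<and> s b = a then signed_term s else 0)
    = x (a \<otimes> b) ^ 2 * (y (a \<otimes> b) ^ 2 - y (a \<otimes> a) * y (b \<otimes> b))"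
proof (cases "a = b")
  case True
  then show ?thesis by (simp add: power2_eq_square)
next
  case False
  let ?f = "transpose a b"
  have f: "?f c \<in> A" if "c \<in> {a, b}" for c using that ab by (auto simp: transpose_def)
  have "D * (D * (\<Sum>s | s permutes A \<and> s a = b \<and> s b = a. signed_term s))
      = D * (x (a \<otimes> b) ^ 2 * (y (a \<otimes> b) ^ 2 - y (a \<otimes> a) * y (b \<otimes> b)))"
    using jacobi[of "{a, b}" ?f, OF _ f] ab False
    by (simp add: set_det_2 M_def power2_eq_square x_comm[OF ab] y_comm[OF ab] algebra_simps)
  then have "D * (\<Sum>s | s permutes A \<and> s a = b \<and> s b = a. signed_term s)
      = x (a \<otimes> b) ^ 2 * (y (a \<otimes> b) ^ 2 - y (a \<otimes> a) * y (b \<otimes> b))"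
    by (rule cancel)
  moreover have "(\<Sum>s | s permutes A. if a \<noteq> b \<and> s a = b \<and> s b = a then signed_term s else 0)
      = (\<Sum>s | s permutes A \<and> s a = b \<and> s b = a. signed_term s)"
    using sum.inter_filter[OF finite_permutations[OF fin], of signed_term "\<lambda>s. s a = b \<and> s b = a"] False by simp
  ultimately show ?thesis by simp
qed

text \<open>
  The sign of the transposition turns the minor of \<open>y\<close> on \<open>a\<close>, \<open>b\<close>, \<open>d\<close> into its negative. Like
  the left-hand side it vanishes when two of the points coincide, so that in sums \<open>a\<close>, \<open>b\<close>, \<open>d\<close> can
  range independently.
\<close>
lemma swap_fix_sum_at:
  assumes abd: "a \<in> A" "b \<in> A" "d \<in> A"
  shows "D * (D * (\<Sum>s | s permutes A. if a \<noteq> b \<and> s a = b \<and> s b = a \<and> s d = d then signed_term s else 0))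
    = x (a \<otimes> b) ^ 2 * x (d \<otimes> d) * (y (a \<otimes> b) ^ 2 * y (d \<otimes> d) - y (a \<otimes> a) * y (b \<otimes> b) * y (d \<otimes> d)
        + y (b \<otimes> b) * y (a \<otimes> d) ^ 2 + y (a \<otimes> a) * y (b \<otimes> d) ^ 2
        - 2 * (y (a \<otimes> b) * y (a \<otimes> d) * y (b \<otimes> d)))"
    (is "_ = ?r")
proof (cases "a = b \<or> a = d \<or> b = d")
  case True
  then have "(if a \<noteq> b \<and> s a = b \<and> s b = a \<and> s d = d then signed_term s else 0) = 0" for s by auto
  moreover have "?r = 0"
    using True abd y_comm by (auto simp: power2_eq_square algebra_simps)
  ultimately show ?thesis by simp
next
  case False
  then have ne: "a \<noteq> b" "b \<noteq> d" "a \<noteq> d" by auto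
  let ?f = "transpose a b"
  have f: "?f c \<in> A" if "c \<in> {a, b, d}" for c using that abd by (auto simp: transpose_def)
  have "D * (D * (D * (\<Sum>s | s permutes A \<and> s a = b \<and> s b = a \<and> s d = d. signed_term s))) = D * ?r"
    using jacobi[of "{a, b, d}" ?f, OF _ f] abd ne
    by (simp add: set_det_3 M_def power2_eq_square x_comm y_comm[of a b] y_comm[of a d] y_comm[of b d]
        numeral_3_eq_3 algebra_simps)
  then have "D * (D * (\<Sum>s | s permutes A \<and> s a = b \<and> s b = a \<and> s d = d. signed_term s)) = ?r"
    by (rule cancel)
  moreover have "(\<Sum>s | s permutes A. if a \<noteq> b \<and> s a = b \<and> s b = a \<and> s d = d then signed_term s else 0)
      = (\<Sum>s | s permutes A \<and> s a = b \<and> s b = a \<and> s d = d. signed_term s)"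
    using sum.inter_filter[OF finite_permutations[OF fin], of signed_term "\<lambda>s. s a = b \<and> s b = a \<and> s d = d"] ne
    by simp
  ultimately show ?thesis by simp
qed

text \<open>
  Substituting \<open>p = a \<otimes> b\<close> and \<open>r = a \<otimes> d\<close>, the variable \<open>a\<close> occurs only through \<open>inv a \<otimes> inv a\<close>,
  which runs over the whole group. The inner sum is then an entry of the product of the two matrices.
\<close>
lemma cyclic_sum:
  "(\<Sum>a\<in>A. \<Sum>b\<in>A. \<Sum>d\<in>A. x (a \<otimes> b) ^ 2 * x (d \<otimes> d) * (y (a \<otimes> b) * y (a \<otimes> d) * y (b \<otimes> d)))
    = D * (\<Sum>p\<in>A. x p ^ 2 * y p ^ 2)"
proof -
  let ?g = "\<lambda>a b d. x (a \<otimes> b) ^ 2 * x (d \<otimes> d) * (y (a \<otimes> b) * y (a \<otimes> d) * y (b \<otimes> d))"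
  let ?h = "\<lambda>p r s. x p ^ 2 * y p * y r * (x (s \<otimes> (r \<otimes> r)) * y (s \<otimes> (p \<otimes> r)))"
  have "(\<Sum>b\<in>A. \<Sum>d\<in>A. ?g a b d) = (\<Sum>p\<in>A. \<Sum>r\<in>A. ?h p r (inv a \<otimes> inv a))" if a: "a \<in> A" for a
  proof -
    have "(\<Sum>b\<in>A. \<Sum>d\<in>A. ?g a b d) = (\<Sum>p\<in>A. \<Sum>d\<in>A. ?g a (inv a \<otimes> p) d)"
      using sum_translate[of "inv a" "\<lambda>b. \<Sum>d\<in>A. ?g a b d"] a by simp
    also have "\<dots> = (\<Sum>p\<in>A. \<Sum>r\<in>A. ?g a (inv a \<otimes> p) (inv a \<otimes> r))"
    proof (rule sum.cong[OF refl])
      fix p assume "p \<in> A"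
      then show "(\<Sum>d\<in>A. ?g a (inv a \<otimes> p) d) = (\<Sum>r\<in>A. ?g a (inv a \<otimes> p) (inv a \<otimes> r))"
        using sum_translate[of "inv a" "\<lambda>d. ?g a (inv a \<otimes> p) d"] a by simp
    qed
    also have "\<dots> = (\<Sum>p\<in>A. \<Sum>r\<in>A. ?h p r (inv a \<otimes> inv a))"
    proof (intro sum.cong refl)
      fix p r assume pr: "p \<in> A" "r \<in> A"
      have "a \<otimes> (inv a \<otimes> p) = p" "a \<otimes> (inv a \<otimes> r) = r"
        using a pr by (simp_all flip: m_assoc)
      moreover have "inv a \<otimes> r \<otimes> (inv a \<otimes> r) = inv a \<otimes> inv a \<otimes> (r \<otimes> r)"
        "inv a \<otimes> p \<otimes> (inv a \<otimes> r) = inv a \<otimes> inv a \<otimes> (p \<otimes> r)"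
        using a pr by (simp_all add: m_ac)
      ultimately show "?g a (inv a \<otimes> p) (inv a \<otimes> r) = ?h p r (inv a \<otimes> inv a)"
        by (simp add: mult_ac)
    qed
    finally show ?thesis .
  qed
  then have "(\<Sum>a\<in>A. \<Sum>b\<in>A. \<Sum>d\<in>A. ?g a b d) = (\<Sum>a\<in>A. \<Sum>p\<in>A. \<Sum>r\<in>A. ?h p r (inv a \<otimes> inv a))"
    by (rule sum.cong[OF refl])
  also have "\<dots> = (\<Sum>a\<in>A. \<Sum>p\<in>A. \<Sum>r\<in>A. ?h p r a)"
    using sum_inverse[of "\<lambda>a. \<Sum>p\<in>A. \<Sum>r\<in>A. ?h p r (a \<otimes> a)"]
      sum_square[of "\<lambda>a. \<Sum>p\<in>A. \<Sum>r\<in>A. ?h p r a"] by simp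
  also have "\<dots> = (\<Sum>p\<in>A. \<Sum>a\<in>A. \<Sum>r\<in>A. ?h p r a)"
    by (rule sum.swap)
  also have "\<dots> = (\<Sum>p\<in>A. \<Sum>r\<in>A. \<Sum>a\<in>A. ?h p r a)"
    by (rule sum.cong[OF refl], rule sum.swap)
  also have "\<dots> = (\<Sum>p\<in>A. \<Sum>r\<in>A. if r = p then D * (x p ^ 2 * y p * y r) else 0)"
  proof (intro sum.cong refl)
    fix p r assume pr: "p \<in> A" "r \<in> A"
    have "r \<otimes> r = p \<otimes> r \<longleftrightarrow> r = p" using pr by simp
    then show "(\<Sum>a\<in>A. ?h p r a) = (if r = p then D * (x p ^ 2 * y p * y r) else 0)"
      unfolding sum_distrib_left[symmetric] using pr by (simp add: orth)
  qed
  also have "\<dots> = (\<Sum>p\<in>A. D * (x p ^ 2 * y p * y p))"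
    by (rule sum.cong[OF refl]) (simp add: fin)
  finally show ?thesis
    by (simp add: sum_distrib_left power2_eq_square mult.assoc)
qed

text \<open>
  Here the substitution is \<open>p = a \<otimes> b\<close> and \<open>s = b \<otimes> d\<close>, after which only \<open>a \<otimes> a\<close> occurs.
\<close>
lemma square_sum:
  "(\<Sum>a\<in>A. \<Sum>b\<in>A. \<Sum>d\<in>A. x (a \<otimes> b) ^ 2 * x (d \<otimes> d) * (y (a \<otimes> a) * y (b \<otimes> d) ^ 2))
    = D * (\<Sum>p\<in>A. x p ^ 2 * y p ^ 2)"
proof -
  let ?g = "\<lambda>a b d. x (a \<otimes> b) ^ 2 * x (d \<otimes> d) * (y (a \<otimes> a) * y (b \<otimes> d) ^ 2)"
  let ?q = "\<lambda>p s. inv p \<otimes> s \<otimes> (inv p \<otimes> s)"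
  let ?h = "\<lambda>p s u. x p ^ 2 * y s ^ 2 * (x (u \<otimes> ?q p s) * y (u \<otimes> \<one>))"
  have "(\<Sum>b\<in>A. \<Sum>d\<in>A. ?g a b d) = (\<Sum>p\<in>A. \<Sum>s\<in>A. ?h p s (a \<otimes> a))" if a: "a \<in> A" for a
  proof -
    have "(\<Sum>b\<in>A. \<Sum>d\<in>A. ?g a b d) = (\<Sum>p\<in>A. \<Sum>d\<in>A. ?g a (inv a \<otimes> p) d)"
      using sum_translate[of "inv a" "\<lambda>b. \<Sum>d\<in>A. ?g a b d"] a by simp
    also have "\<dots> = (\<Sum>p\<in>A. \<Sum>s\<in>A. ?g a (inv a \<otimes> p) (a \<otimes> inv p \<otimes> s))"
    proof (rule sum.cong[OF refl])
      fix p assume "p \<in> A"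
      then show "(\<Sum>d\<in>A. ?g a (inv a \<otimes> p) d) = (\<Sum>s\<in>A. ?g a (inv a \<otimes> p) (a \<otimes> inv p \<otimes> s))"
        using sum_translate[of "a \<otimes> inv p" "\<lambda>d. ?g a (inv a \<otimes> p) d"] a by simp
    qed
    also have "\<dots> = (\<Sum>p\<in>A. \<Sum>s\<in>A. ?h p s (a \<otimes> a))"
    proof (intro sum.cong refl)
      fix p s assume ps: "p \<in> A" "s \<in> A"
      have "a \<otimes> (inv a \<otimes> p) = p" using a ps by (simp flip: m_assoc)
      moreover have "a \<otimes> inv p \<otimes> s \<otimes> (a \<otimes> inv p \<otimes> s) = a \<otimes> a \<otimes> ?q p s"
        using a ps by (simp add: m_ac)
      moreover have "inv a \<otimes> p \<otimes> (a \<otimes> inv p \<otimes> s) = s"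
      proof -
        have "inv a \<otimes> p \<otimes> (a \<otimes> inv p \<otimes> s) = (inv a \<otimes> a) \<otimes> (p \<otimes> inv p) \<otimes> s"
          using a ps by (simp only: m_ac m_closed inv_closed)
        then show ?thesis using a ps by simp
      qed
      ultimately show "?g a (inv a \<otimes> p) (a \<otimes> inv p \<otimes> s) = ?h p s (a \<otimes> a)"
        using a by (simp add: mult_ac)
    qed
    finally show ?thesis .
  qed
  then have "(\<Sum>a\<in>A. \<Sum>b\<in>A. \<Sum>d\<in>A. ?g a b d) = (\<Sum>a\<in>A. \<Sum>p\<in>A. \<Sum>s\<in>A. ?h p s (a \<otimes> a))"
    by (rule sum.cong[OF refl])
  also have "\<dots> = (\<Sum>a\<in>A. \<Sum>p\<in>A. \<Sum>s\<in>A. ?h p s a)"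
    by (rule sum_square[of "\<lambda>a. \<Sum>p\<in>A. \<Sum>s\<in>A. ?h p s a"])
  also have "\<dots> = (\<Sum>p\<in>A. \<Sum>a\<in>A. \<Sum>s\<in>A. ?h p s a)"
    by (rule sum.swap)
  also have "\<dots> = (\<Sum>p\<in>A. \<Sum>s\<in>A. \<Sum>a\<in>A. ?h p s a)"
    by (rule sum.cong[OF refl], rule sum.swap)
  also have "\<dots> = (\<Sum>p\<in>A. \<Sum>s\<in>A. if s = p then D * (x p ^ 2 * y s ^ 2) else 0)"
  proof (intro sum.cong refl)
    fix p s assume ps: "p \<in> A" "s \<in> A"
    have "?q p s = \<one> \<longleftrightarrow> inv p \<otimes> s = \<one>"
      using square_eq_iff[of "inv p \<otimes> s" \<one>] ps by simp
    also have "\<dots> \<longleftrightarrow> s = p"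
      using ps by (metis inv_closed inv_equality inv_inv l_inv m_comm)
    finally have iff: "?q p s = \<one> \<longleftrightarrow> s = p" .
    have "(\<Sum>a\<in>A. ?h p s a) = x p ^ 2 * y s ^ 2 * (if ?q p s = \<one> then D else 0)"
      unfolding sum_distrib_left[symmetric] by (subst orth) (use ps in simp_all)
    then show "(\<Sum>a\<in>A. ?h p s a) = (if s = p then D * (x p ^ 2 * y s ^ 2) else 0)"
      unfolding iff by simp
  qed
  also have "\<dots> = (\<Sum>p\<in>A. D * (x p ^ 2 * y p ^ 2))"
    by (rule sum.cong[OF refl]) (simp add: fin)
  finally show ?thesis by (simp add: sum_distrib_left)
qed

lemma swapped_sum_eq:
  "(\<Sum>s | s permutes A. of_int (fixed_count A s * swapped_count A s) * signed_term s)
    = (\<Sum>s | s permutes A. of_int (swapped_count A s) * signed_term s)"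
proof -
  let ?P = "{s. s permutes A}"
  let ?t2 = "\<lambda>a b s. if a \<noteq> b \<and> s a = b \<and> s b = a then signed_term s else 0"
  let ?t3 = "\<lambda>a b d s. if a \<noteq> b \<and> s a = b \<and> s b = a \<and> s d = d then signed_term s else 0"
  let ?Q = "\<lambda>a b. x (a \<otimes> b) ^ 2 * (y (a \<otimes> b) ^ 2 - y (a \<otimes> a) * y (b \<otimes> b))"
  let ?T2 = "\<Sum>s\<in>?P. of_int (swapped_count A s) * signed_term s"
  let ?T3 = "\<Sum>s\<in>?P. of_int (fixed_count A s * swapped_count A s) * signed_term s"
  have T2: "?T2 = (\<Sum>a\<in>A. \<Sum>b\<in>A. \<Sum>s\<in>?P. ?t2 a b s)"
  proof -
    have "?T2 = (\<Sum>s\<in>?P. \<Sum>a\<in>A. \<Sum>b\<in>A. ?t2 a b s)"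
      unfolding swapped_count_def of_int_sum sum_distrib_right by (intro sum.cong refl) simp
    also have "\<dots> = (\<Sum>a\<in>A. \<Sum>s\<in>?P. \<Sum>b\<in>A. ?t2 a b s)" by (rule sum.swap)
    also have "\<dots> = (\<Sum>a\<in>A. \<Sum>b\<in>A. \<Sum>s\<in>?P. ?t2 a b s)"
      by (rule sum.cong[OF refl], rule sum.swap)
    finally show ?thesis .
  qed
  have T3: "?T3 = (\<Sum>a\<in>A. \<Sum>b\<in>A. \<Sum>d\<in>A. \<Sum>s\<in>?P. ?t3 a b d s)"
  proof -
    have "?T3 = (\<Sum>s\<in>?P. \<Sum>a\<in>A. \<Sum>b\<in>A. \<Sum>d\<in>A. ?t3 a b d s)"
    proof (rule sum.cong[OF refl])
      fix s
      have "of_int (fixed_count A s * swapped_count A s) * signed_term s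
          = (\<Sum>a\<in>A. \<Sum>b\<in>A. (if a \<noteq> b \<and> s a = b \<and> s b = a then 1 else 0)
              * (\<Sum>d\<in>A. (if s d = d then 1 else 0) * signed_term s))"
        unfolding of_int_mult swapped_count_def fixed_count_def of_int_sum sum_distrib_right[symmetric]
        by (simp add: mult_ac if_distrib[of of_int] cong: if_cong)
      also have "\<dots> = (\<Sum>a\<in>A. \<Sum>b\<in>A. \<Sum>d\<in>A. ?t3 a b d s)"
        unfolding sum_distrib_left by (intro sum.cong refl) simp
      finally show "of_int (fixed_count A s * swapped_count A s) * signed_term s
          = (\<Sum>a\<in>A. \<Sum>b\<in>A. \<Sum>d\<in>A. ?t3 a b d s)" .
    qed
    also have "\<dots> = (\<Sum>a\<in>A. \<Sum>s\<in>?P. \<Sum>b\<in>A. \<Sum>d\<in>A. ?t3 a b d s)" by (rule sum.swap)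
    also have "\<dots> = (\<Sum>a\<in>A. \<Sum>b\<in>A. \<Sum>s\<in>?P. \<Sum>d\<in>A. ?t3 a b d s)"
      by (rule sum.cong[OF refl], rule sum.swap)
    also have "\<dots> = (\<Sum>a\<in>A. \<Sum>b\<in>A. \<Sum>d\<in>A. \<Sum>s\<in>?P. ?t3 a b d s)"
      by (rule sum.cong[OF refl], rule sum.cong[OF refl], rule sum.swap)
    finally show ?thesis .
  qed
  have D_T2: "D * ?T2 = (\<Sum>a\<in>A. \<Sum>b\<in>A. ?Q a b)"
    unfolding T2
    by (subst sum_distrib_left, rule sum.cong[OF refl], subst sum_distrib_left,
        rule sum.cong[OF refl], rule swap_sum_at)
  \<comment> \<open>The factor \<open>D\<close> on the left is squared because the minors have size 3.\<close>
  let ?c = "\<lambda>a b d. x (a \<otimes> b) ^ 2 * x (d \<otimes> d) * (y (a \<otimes> b) * y (a \<otimes> d) * y (b \<otimes> d))"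
  let ?e = "\<lambda>a b d. x (a \<otimes> b) ^ 2 * x (d \<otimes> d) * (y (a \<otimes> a) * y (b \<otimes> d) ^ 2)"
  let ?N = "D * (\<Sum>p\<in>A. x p ^ 2 * y p ^ 2)"
  have "D * (D * ?T3) = (\<Sum>a\<in>A. \<Sum>b\<in>A. \<Sum>d\<in>A. D * (D * (\<Sum>s\<in>?P. ?t3 a b d s)))"
    unfolding T3 by (simp only: sum_distrib_left)
  also have "\<dots> = (\<Sum>a\<in>A. \<Sum>b\<in>A. \<Sum>d\<in>A. ?Q a b * (x (d \<otimes> d) * y (d \<otimes> d))
      + ?e b a d + ?e a b d - 2 * ?c a b d)"
  proof (intro sum.cong refl)
    fix a b d assume abd: "a \<in> A" "b \<in> A" "d \<in> A"
    show "D * (D * (\<Sum>s\<in>?P. ?t3 a b d s)) = ?Q a b * (x (d \<otimes> d) * y (d \<otimes> d))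
      + ?e b a d + ?e a b d - 2 * ?c a b d"
      unfolding swap_fix_sum_at[OF abd] x_comm[OF abd(1,2)] by (simp add: algebra_simps)
  qed
  also have "\<dots> = (\<Sum>a\<in>A. \<Sum>b\<in>A. ?Q a b * (\<Sum>d\<in>A. x (d \<otimes> d) * y (d \<otimes> d)))
      + (\<Sum>a\<in>A. \<Sum>b\<in>A. \<Sum>d\<in>A. ?e b a d) + (\<Sum>a\<in>A. \<Sum>b\<in>A. \<Sum>d\<in>A. ?e a b d)
      - 2 * (\<Sum>a\<in>A. \<Sum>b\<in>A. \<Sum>d\<in>A. ?c a b d)"
    by (simp only: sum.distrib sum_subtractf sum_distrib_left)
  also have "\<dots> = D * (D * ?T2) + ?N + ?N - 2 * ?N"
  proof -
    have "(\<Sum>a\<in>A. \<Sum>b\<in>A. \<Sum>d\<in>A. ?e b a d) = ?N"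
      using square_sum by (rule trans[OF sum.swap])
    moreover have "(\<Sum>a\<in>A. \<Sum>b\<in>A. ?Q a b * (\<Sum>d\<in>A. x (d \<otimes> d) * y (d \<otimes> d))) = D * (D * ?T2)"
      unfolding D_T2 sum_diagonal sum_distrib_right[symmetric] by (rule mult.commute)
    ultimately show ?thesis by (simp only: square_sum cyclic_sum)
  qed
  finally have "D * (D * ?T3) = D * (D * ?T2)" by simp
  then show ?thesis using cancel by blast
qed

end

text \<open>
  Expand \<open>(p - 1) * (1 - w) = p - 1 - p * w + w\<close>: the first two weights and the last two give
  equal sums.
\<close>
theorem signed_sum_zero:
  "(\<Sum>s | s permutes A. of_int (sign s * ((fixed_count A s - 1) * (1 - swapped_count A s)))
      * (\<Prod>a\<in>A. x (a \<otimes> s a))) = 0"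
proof (rule inverse_entries_ex)
  fix y
  assume y: "\<And>u v. u \<in> A \<Longrightarrow> v \<in> A \<Longrightarrow>
      (\<Sum>s\<in>A. x (s \<otimes> u) * y (s \<otimes> v)) = (if u = v then D else 0)"
    "\<And>a c. a \<in> A \<Longrightarrow> c \<in> A \<Longrightarrow> (\<Sum>b\<in>A. y (a \<otimes> b) * M b c) = (if a = c then set_det A M else 0)"
  have "(\<Sum>s | s permutes A. of_int (sign s * ((fixed_count A s - 1) * (1 - swapped_count A s)))
      * (\<Prod>a\<in>A. x (a \<otimes> s a)))
    = (\<Sum>s | s permutes A. of_int (fixed_count A s) * signed_term s - signed_term s
        - of_int (fixed_count A s * swapped_count A s) * signed_term s + of_int (swapped_count A s) * signed_term s)"
    by (rule sum.cong[OF refl]) (simp add: signed_term_def M_def algebra_simps)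
  also have "\<dots> = 0"
  proof -
    have "(\<Sum>s | s permutes A. of_int (fixed_count A s) * signed_term s) = D"
      using y by (rule fixed_sum)
    moreover have "(\<Sum>s | s permutes A. of_int (fixed_count A s * swapped_count A s) * signed_term s)
        = (\<Sum>s | s permutes A. of_int (swapped_count A s) * signed_term s)"
      using y by (rule swapped_sum_eq)
    ultimately show ?thesis
      unfolding sum.distrib sum_subtractf by (simp only: D_eq[symmetric]) simp
  qed
  finally show ?thesis .
qed

end

section \<open>Reduction to a regular determinant and conclusion\<close>
lemma coeff_mult_degree_bounds:
  fixes p q :: "'r :: comm_semiring_0 poly"
  assumes "degree p \<le> m" "degree q \<le> k"
  shows "coeff (p * q) (m + k) = coeff p m * coeff q k"
proof -
  have "coeff (p * q) (m + k) = (\<Sum>i\<le>m + k. if i = m then coeff p m * coeff q k else 0)"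
    unfolding coeff_mult
  proof (rule sum.cong[OF refl])
    fix i assume "i \<in> {..m + k}"
    then consider "i < m" "k < m + k - i" | "i = m" | "i > m" by fastforce
    then show "coeff p i * coeff q (m + k - i) = (if i = m then coeff p m * coeff q k else 0)"
      by cases (use assms in \<open>auto simp: coeff_eq_0\<close>)
  qed
  then show ?thesis by simp
qed

lemma prod_linear_polys:
  fixes p :: "'a \<Rightarrow> 'r :: comm_ring_1 poly"
  assumes "finite A" "\<And>a. a \<in> A \<Longrightarrow> degree (p a) \<le> 1"
  shows "degree (\<Prod>a\<in>A. p a) \<le> card A \<and> coeff (\<Prod>a\<in>A. p a) (card A) = (\<Prod>a\<in>A. coeff (p a) 1)"
  using assms
proof (induction A rule: finite_induct)
  case empty
  then show ?case by simp
next
  case (insert b F)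
  then have IH: "degree (\<Prod>a\<in>F. p a) \<le> card F" "coeff (\<Prod>a\<in>F. p a) (card F) = (\<Prod>a\<in>F. coeff (p a) 1)"
    and b: "degree (p b) \<le> 1" by auto
  have "degree (p b * (\<Prod>a\<in>F. p a)) \<le> 1 + card F"
    using degree_mult_le[of "p b" "\<Prod>a\<in>F. p a"] IH(1) b by linarith
  moreover have "coeff (p b * (\<Prod>a\<in>F. p a)) (1 + card F) = coeff (p b) 1 * coeff (\<Prod>a\<in>F. p a) (card F)"
    by (rule coeff_mult_degree_bounds[OF b IH(1)])
  ultimately show ?case using insert.hyps IH(2) by simp
qed

context comm_group
begin

text \<open>
  The new variable occurs in one entry of each row, so its \<open>n\<close>-th power occurs in the
  determinant exactly for the permutation \<open>a \<mapsto> inv a\<close> and has coefficient \<open>1\<close> or \<open>-1\<close>.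
\<close>
lemma generic_determinant_regular:
  fixes x :: "'a \<Rightarrow> 'r :: comm_ring_1"
  assumes fin: "finite (carrier G)"
  defines "z \<equiv> \<lambda>g. [:x g, if g = \<one> then 1 else 0:]"
  assumes zero: "set_det (carrier G) (\<lambda>a b. z (a \<otimes> b)) * r = 0"
  shows "r = 0"
proof -
  let ?A = "carrier G"
  let ?D = "set_det ?A (\<lambda>a b. z (a \<otimes> b))"
  define i where "i = (\<lambda>a. if a \<in> ?A then inv a else a)"
  have i: "i permutes ?A"
    by (rule bij_imp_permutes, rule bij_betw_byWitness[where f' = i]) (auto simp: i_def)
  have deg: "degree (z g) \<le> 1" for g unfolding z_def by simp
  have prod: "degree (\<Prod>a\<in>?A. z (a \<otimes> s a)) \<le> card ?A"
    "coeff (\<Prod>a\<in>?A. z (a \<otimes> s a)) (card ?A) = (\<Prod>a\<in>?A. coeff (z (a \<otimes> s a)) 1)" for s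
    using prod_linear_polys[OF fin, of "\<lambda>a. z (a \<otimes> s a)"] deg by auto
  have of_int_poly: "(of_int k :: 'r poly) = [:of_int k:]" for k
    by (rule of_int_poly)
  have "degree ?D \<le> card ?A"
    unfolding set_det_def
  proof (rule degree_sum_le)
    show "finite {s. s permutes ?A}" using finite_permutations[OF fin] .
    show "degree (of_int (sign s) * (\<Prod>a\<in>?A. z (a \<otimes> s a))) \<le> card ?A" for s
      unfolding of_int_poly using prod(1)[of s] degree_smult_le order_trans by fastforce
  qed
  moreover have "coeff ?D (card ?A) = of_int (sign i)"
  proof -
    have "coeff ?D (card ?A)
        = (\<Sum>s | s permutes ?A. of_int (sign s) * (\<Prod>a\<in>?A. coeff (z (a \<otimes> s a)) 1))"
      unfolding set_det_def coeff_sum of_int_poly by (simp add: prod(2))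
    also have "\<dots> = (\<Sum>s | s permutes ?A. if s = i then of_int (sign i) else 0)"
    proof (rule sum.cong[OF refl])
      fix s assume "s \<in> {s. s permutes ?A}"
      then have s: "s permutes ?A" by simp
      show "of_int (sign s) * (\<Prod>a\<in>?A. coeff (z (a \<otimes> s a)) 1) = (if s = i then of_int (sign i) else 0)"
      proof (cases "s = i")
        case True
        then show ?thesis by (simp add: z_def i_def)
      next
        case False
        then obtain a where a: "s a \<noteq> i a" by auto
        then have aA: "a \<in> ?A" using permutes_not_in[OF s] by (cases "a \<in> ?A") (simp_all add: i_def)
        then have "s a \<in> ?A" using s by (simp add: permutes_in_image)
        then have "a \<otimes> s a \<noteq> \<one>"
          using a aA inv_equality[of "s a" a] m_comm[of "s a" a] by (auto simp: i_def)
        then have "coeff (z (a \<otimes> s a)) 1 = 0" by (simp add: z_def)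
        then have "(\<Prod>a\<in>?A. coeff (z (a \<otimes> s a)) 1) = 0" using aA fin by (intro prod_zero) auto
        then show ?thesis using False by simp
      qed
    qed
    also have "\<dots> = of_int (sign i)"
      using i finite_permutations[OF fin] by simp
    finally show ?thesis .
  qed
  ultimately have "of_int (sign i) * lead_coeff r = 0"
    using coeff_mult_degree_bounds[of ?D "card ?A" r "degree r"] zero by simp
  then have "lead_coeff r = 0" by (cases i rule: sign_cases) auto
  then show ?thesis by simp
qed

theorem cayley_signed_sum_zero:
  fixes x :: "'a \<Rightarrow> 'r :: comm_ring_1"
  assumes fin: "finite (carrier G)" and odd: "odd (order G)"
  shows "(\<Sum>s | s permutes carrier G.
      of_int (sign s * ((fixed_count (carrier G) s - 1) * (1 - swapped_count (carrier G) s)))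
      * (\<Prod>a\<in>carrier G. x (a \<otimes> s a))) = 0" (is "?S = 0")
proof -
  \<comment> \<open>Evaluation at \<open>0\<close> is a ring homomorphism that takes \<open>?z g\<close> back to \<open>x g\<close>.\<close>
  let ?z = "\<lambda>g. [:x g, if g = \<one> then 1 else 0:]"
  interpret z: odd_group_matrix G ?z
    by unfold_locales (use fin odd generic_determinant_regular[OF fin] in auto)
  have "poly (\<Sum>s | s permutes carrier G.
      of_int (sign s * ((fixed_count (carrier G) s - 1) * (1 - swapped_count (carrier G) s)))
      * (\<Prod>a\<in>carrier G. ?z (a \<otimes> s a))) 0 = 0"
    unfolding z.signed_sum_zero by simp
  then show ?thesis
    by (simp only: poly_sum poly_mult poly_prod of_int_poly poly_pCons poly_0) simp
qed

end

lemma const_poly_of_int: "const_poly (of_int k) = of_int k"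
  unfolding const_poly_def by simp

theorem theorem1p6:
  fixes G :: "('a, 'm) monoid_scheme" and n :: nat
  assumes "comm_group G" and "finite (carrier G)"
    and "order G = n" and "odd n" and "n \<ge> 7"
  shows "immanant (4 # replicate (n - 4) 1) (carrier G) (cayley_table G) =
         immanant ([2, 2, 2] @ replicate (n - 6) 1) (carrier G) (cayley_table G)"
proof -
  interpret comm_group G by fact
  let ?A = "carrier G"
  let ?P = "\<lambda>s. \<Prod>a\<in>?A. cayley_table G a (s a)"
  have card: "card ?A = n" using assms(3) by (simp add: Coset.order_def)
  have "immanant (hook4 n) ?A (cayley_table G) - immanant (shape222 n) ?A (cayley_table G)
      = (\<Sum>s | s permutes ?A. const_poly (sym_char (hook4 n) ?A s - sym_char (shape222 n) ?A s) * ?P s)"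
    unfolding immanant_def sum_subtractf[symmetric] left_diff_distrib[symmetric] const_poly_def single_diff ..
  also have "\<dots> = (\<Sum>s | s permutes ?A.
      of_int (sign s * ((fixed_count ?A s - 1) * (1 - swapped_count ?A s))) * (\<Prod>a\<in>?A. indet (a \<otimes>\<^bsub>G\<^esub> s a)))"
    by (rule sum.cong[OF refl])
      (simp only: mem_Collect_eq character_difference[OF assms(2) card assms(5)] const_poly_of_int cayley_table_def)
  also have "\<dots> = 0"
    by (rule cayley_signed_sum_zero) (use assms in auto)
  finally show ?thesis
    unfolding hook4_def shape222_def by simp
qed

end
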